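(* Suppose $G$ is a non-elementary GBS group with $\beta(G)=0$. Then for all $\phi\in\operatorname{Aut}(G)$, $\operatorname{Fix}(\phi)$ is finitely generated.
   Context: A generalised Baumslag-Solitar (GBS) group is a finitely generated group $G$ admitting an action on a tree $T$ (as usual in Bass-Serre theory, by graph automorphisms without edge inversions) in which all edge and vertex stabilisers are infinite cyclic. It is non-elementary if it is not isomorphic to $\mathbb{Z}$, $\mathbb{Z}^2$ or the Klein bottle group. $\beta(G)$ is the first Betti number $1-|V(T/G)|+|E(T/G)|$ of the quotient graph $T/G$; for non-elementary $G$ it does not depend on the choice of such a tree $T$. Thus $\beta(G)=0$ means that $T/G$ is a tree for some (equivalently, any) such $T$. $\operatorname{Fix}(\phi)=\{g\in G\mid\phi(g)=g\}$. *)

theory Defs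
  imports
    "HOL-Algebra.Elementary_Groups"
    "HOL-Algebra.Group_Action"
    "Graph_Theory.Bidirected_Digraph"
    "Graph_Theory.Digraph_Component"
    "Graph_Theory.Arc_Walk"
begin

section \<open>Groups\<close>

definition finitely_generated_group :: "('a, 'm) monoid_scheme \<Rightarrow> bool" where
  "finitely_generated_group G \<longleftrightarrow>
     group G \<and> (\<exists>S. finite S \<and> S \<subseteq> carrier G \<and> generate G S = carrier G)"

definition infinite_cyclic_group :: "('a, 'm) monoid_scheme \<Rightarrow> bool" where
  "infinite_cyclic_group G \<longleftrightarrow> group G \<and> G \<cong> integer_group"

text \<open>The Klein bottle group \<open>\<langle>a, t | t a t\<inverse> = a\<inverse>\<rangle>\<close>, with \<open>(i, j)\<close> standing for
  \<open>a\<^sup>i t\<^sup>j\<close>, that is, the semidirect product of the integers with themselves in which the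
  generator \<open>t\<close> acts by negation.\<close>

definition klein_bottle_group :: "(int \<times> int) monoid" where
  "klein_bottle_group =
     \<lparr>carrier = UNIV,
      monoid.mult = (\<lambda>(i, j) (k, l). (i + (if even j then k else - k), j + l)),
      one = (0, 0)\<rparr>"

lemma group_klein_bottle_group: "group klein_bottle_group"
proof (rule groupI)
  fix x assume "x \<in> carrier klein_bottle_group"
  obtain i j where "x = (i, j)" by (cases x)
  then show "\<exists>y\<in>carrier klein_bottle_group. y \<otimes>\<^bsub>klein_bottle_group\<^esub> x = \<one>\<^bsub>klein_bottle_group\<^esub>"
    by (intro bexI[of _ "(if even j then - i else i, - j)"]) (auto simp: klein_bottle_group_def)
qed (auto simp: klein_bottle_group_def split: prod.splits)

definition elementary_gbs_group :: "('a, 'm) monoid_scheme \<Rightarrow> bool" where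
  "elementary_gbs_group G \<longleftrightarrow>
     G \<cong> integer_group \<or> G \<cong> integer_group \<times>\<times> integer_group \<or> G \<cong> klein_bottle_group"

definition fixed_points :: "('a, 'm) monoid_scheme \<Rightarrow> ('a \<Rightarrow> 'a) \<Rightarrow> 'a set" where
  "fixed_points G \<phi> = {g \<in> carrier G. \<phi> g = g}"

lemma (in group) subgroup_fixed_points:
  assumes "\<phi> \<in> auto G"
  shows "subgroup (fixed_points G \<phi>) G"
proof -
  interpret h: group_hom G G \<phi>
    using assms by unfold_locales (simp add: auto_def)
  show ?thesis
    by unfold_locales (auto simp: fixed_points_def)
qed


section \<open>Graphs and trees\<close>

text \<open>Graphs are graphs in the sense of Serre, rendered by \<^locale>\<open>bidirected_digraph\<close>: each arc
  \<open>a\<close> comes with an opposite arc \<open>arev a \<noteq> a\<close>, and an unoriented edge is a pair \<open>{a, arev a}\<close>.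
  Loops and multiple edges are allowed.

  Every edge yields the directed cycle \<open>[a, arev a]\<close>, so \<^const>\<open>tree\<close>, which forbids all
  directed cycles, is not the notion needed here; circuits must not backtrack.\<close>

definition circuit :: "('v, 'e) pre_digraph \<Rightarrow> ('e \<Rightarrow> 'e) \<Rightarrow> 'e list \<Rightarrow> bool" where
  "circuit X arev p \<longleftrightarrow> pre_digraph.cycle X p \<and> successively (\<lambda>a b. b \<noteq> arev a) p"

definition bidirected_tree :: "('v, 'e) pre_digraph \<Rightarrow> ('e \<Rightarrow> 'e) \<Rightarrow> bool" where
  "bidirected_tree X arev \<longleftrightarrow>
     bidirected_digraph X arev \<and> strongly_connected X \<and> (\<nexists>p. circuit X arev p)"

definition edges :: "('v, 'e) pre_digraph \<Rightarrow> ('e \<Rightarrow> 'e) \<Rightarrow> 'e set set" where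
  "edges X arev = {{a, arev a} | a. a \<in> arcs X}"

text \<open>Only meaningful for finite connected graphs.\<close>

definition first_betti :: "('v, 'e) pre_digraph \<Rightarrow> ('e \<Rightarrow> 'e) \<Rightarrow> int" where
  "first_betti X arev = 1 - int (card (verts X)) + int (card (edges X arev))"


section \<open>Actions on graphs without inversions\<close>

locale graph_action =
  bidirected_digraph X arev +
  on_verts: group_action G "verts X" \<alpha> +
  on_arcs: group_action G "arcs X" \<beta>
  for G (structure) and X :: "('v, 'e) pre_digraph" and arev \<alpha> \<beta> +
  assumes tail_equivariant:
      "\<lbrakk>g \<in> carrier G; a \<in> arcs X\<rbrakk> \<Longrightarrow> tail X (\<beta> g a) = \<alpha> g (tail X a)"
    and head_equivariant:
      "\<lbrakk>g \<in> carrier G; a \<in> arcs X\<rbrakk> \<Longrightarrow> head X (\<beta> g a) = \<alpha> g (head X a)"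
    and rev_equivariant:
      "\<lbrakk>g \<in> carrier G; a \<in> arcs X\<rbrakk> \<Longrightarrow> \<beta> g (arev a) = arev (\<beta> g a)"
    and no_inversion:
      "\<lbrakk>g \<in> carrier G; a \<in> arcs X\<rbrakk> \<Longrightarrow> \<beta> g a \<noteq> arev a"

text \<open>The tail of an orbit of arcs is the set of tails of its members, which by equivariance is
  an orbit of vertices; likewise for heads and opposites.\<close>

definition quotient_graph ::
  "('a, 'm) monoid_scheme \<Rightarrow> ('v, 'e) pre_digraph \<Rightarrow> ('a \<Rightarrow> 'v \<Rightarrow> 'v) \<Rightarrow> ('a \<Rightarrow> 'e \<Rightarrow> 'e) \<Rightarrow>
     ('v set, 'e set) pre_digraph" where
  "quotient_graph G X \<alpha> \<beta> =
     \<lparr>verts = orbits G (verts X) \<alpha>, arcs = orbits G (arcs X) \<beta>,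
      tail = (\<lambda>A. tail X ` A), head = (\<lambda>A. head X ` A)\<rparr>"

definition quotient_arev ::
  "('a, 'm) monoid_scheme \<Rightarrow> ('v, 'e) pre_digraph \<Rightarrow> ('e \<Rightarrow> 'e) \<Rightarrow> ('a \<Rightarrow> 'e \<Rightarrow> 'e) \<Rightarrow>
     'e set \<Rightarrow> 'e set" where
  "quotient_arev G X arev \<beta> A = (if A \<in> orbits G (arcs X) \<beta> then arev ` A else A)"

context graph_action
begin

lemma tail_orbit:
  assumes "a \<in> arcs X"
  shows "tail X ` orbit G \<beta> a = orbit G \<alpha> (tail X a)"
  using assms by (auto simp: orbit_def tail_equivariant image_iff) (metis tail_equivariant)

lemma head_orbit:
  assumes "a \<in> arcs X"
  shows "head X ` orbit G \<beta> a = orbit G \<alpha> (head X a)"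
  using assms by (auto simp: orbit_def head_equivariant image_iff) (metis head_equivariant)

lemma rev_orbit:
  assumes "a \<in> arcs X"
  shows "arev ` orbit G \<beta> a = orbit G \<beta> (arev a)"
  using assms by (auto simp: orbit_def rev_equivariant image_iff) (metis rev_equivariant)

lemma arc_orbit_subset: "a \<in> arcs X \<Longrightarrow> orbit G \<beta> a \<subseteq> arcs X"
  using on_arcs.element_image by (auto simp: orbit_def)

lemma bidirected_digraph_quotient:
  "bidirected_digraph (quotient_graph G X \<alpha> \<beta>) (quotient_arev G X arev \<beta>)"
proof (rule wf_digraph.bidirected_digraphI)
  show "wf_digraph (quotient_graph G X \<alpha> \<beta>)"
    by unfold_locales (auto simp: quotient_graph_def orbits_def tail_orbit head_orbit,
        (use tail_in_verts head_in_verts in blast)+)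
next
  fix A assume "A \<in> arcs (quotient_graph G X \<alpha> \<beta>)"
  then obtain a where a: "a \<in> arcs X" "A = orbit G \<beta> a"
    by (auto simp: quotient_graph_def orbits_def)
  then have A: "A \<in> orbits G (arcs X) \<beta>" "arev ` A \<in> orbits G (arcs X) \<beta>"
    by (auto simp: orbits_def rev_orbit)
  have sub: "A \<subseteq> arcs X"
    using a arc_orbit_subset by simp
  show "quotient_arev G X arev \<beta> A \<noteq> A"
  proof
    assume "quotient_arev G X arev \<beta> A = A"
    then have "orbit G \<beta> (arev a) = orbit G \<beta> a"
      using A a by (simp add: quotient_arev_def rev_orbit)
    moreover have "arev a \<in> orbit G \<beta> (arev a)"
      using a by (intro on_arcs.orbit_refl) auto
    ultimately have "arev a \<in> orbit G \<beta> a"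
      by simp
    then obtain g where "g \<in> carrier G" "\<beta> g a = arev a"
      unfolding orbit_def by auto
    then show False
      using no_inversion a by blast
  qed
  show "quotient_arev G X arev \<beta> (quotient_arev G X arev \<beta> A) = A"
    using A by (simp add: quotient_arev_def image_image)
  show "tail (quotient_graph G X \<alpha> \<beta>) (quotient_arev G X arev \<beta> A) = head (quotient_graph G X \<alpha> \<beta>) A"
    using A sub by (auto simp: quotient_arev_def quotient_graph_def image_image intro!: image_cong)
qed (auto simp: quotient_arev_def quotient_graph_def)

end


section \<open>Generalised Baumslag-Solitar groups\<close>

text \<open>The locale describes a generalised Baumslag-Solitar group \<open>G\<close> together with a tree
  witnessing this.\<close>

locale gbs_group_on_tree = graph_action G T arev \<alpha> \<beta>
  for G (structure) and T :: "('v, 'e) pre_digraph" and arev \<alpha> \<beta> +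
  assumes finitely_generated: "finitely_generated_group G"
    and tree: "bidirected_tree T arev"
    and vertex_stabilizer:
      "v \<in> verts T \<Longrightarrow> infinite_cyclic_group (G\<lparr>carrier := stabilizer G \<alpha> v\<rparr>)"
    and edge_stabilizer:
      "a \<in> arcs T \<Longrightarrow> infinite_cyclic_group (G\<lparr>carrier := stabilizer G \<beta> a\<rparr>)"

text \<open>\<open>betti_on_tree G T arev \<alpha> \<beta> b\<close> says that \<open>b\<close> is the first Betti number of \<open>G\<close>, as computed
  from the tree \<open>T\<close>. The formula for it requires the quotient \<open>T/G\<close> to be finite.\<close>

definition betti_on_tree ::
  "('a, 'm) monoid_scheme \<Rightarrow> ('v, 'e) pre_digraph \<Rightarrow> ('e \<Rightarrow> 'e) \<Rightarrow>
     ('a \<Rightarrow> 'v \<Rightarrow> 'v) \<Rightarrow> ('a \<Rightarrow> 'e \<Rightarrow> 'e) \<Rightarrow> int \<Rightarrow> bool" where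
  "betti_on_tree G T arev \<alpha> \<beta> b \<longleftrightarrow>
     fin_digraph (quotient_graph G T \<alpha> \<beta>) \<and>
     first_betti (quotient_graph G T \<alpha> \<beta>) (quotient_arev G T arev \<beta>) = b"

end

theory Submission
  imports Defs Complex_Main
begin

text \<open>Let \<open>G\<close> be a GBS group acting on the tree \<open>T\<close>, where \<open>T/G\<close> is a finite tree, and let \<open>\<phi>\<close> be
  an automorphism. The proof finds a homomorphism \<open>\<chi>\<close> from \<open>G\<close> to the integers whose kernel \<open>K\<close> is
  preserved by \<open>\<phi>\<close> and acts freely and with finitely many orbits of arcs on \<open>T\<close>. Then \<open>K\<close> is a free
  group of finite rank, the fixed points of \<open>\<phi>\<close> in \<open>K\<close> are finitely generated by Gersten's theorem,
  and \<open>Fix(\<phi>)\<close> is an extension of these by a subgroup of the integers.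

  \<^bold>\<open>The homomorphism.\<close> Since \<open>T/G\<close> is a tree, it lifts to a finite subtree of \<open>T\<close> with vertex set
  \<open>S\<close>, and \<open>G\<close> is the fundamental group of the resulting tree of groups. All vertex groups are
  commensurable, so some \<open>z\<close> of infinite order lies in the stabilisers of all vertices in \<open>S\<close>; these
  stabilisers generate \<open>G\<close> and are abelian, so \<open>z\<close> is central. An element \<open>x\<close> of a vertex group
  satisfies \<open>x\<^sup>n = z\<^sup>m\<close> for some \<open>n \<noteq> 0\<close>, and sending it to \<open>m/n\<close> is compatible across edges. Hence it
  extends to \<open>G\<close> (\<open>exists_hom_extension\<close>), and clearing denominators gives \<open>\<chi>\<close>
  (\<open>exists_rank_one_hom\<close>). As nonzero powers of these generators of \<open>G\<close> lie in \<open>\<langle>z\<rangle>\<close>, every homomorphism to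
  the integers is a rational multiple of \<open>\<chi>\<close>. This applies to \<open>\<chi> \<circ> \<phi>\<close>, so \<open>\<phi>\<close> preserves \<open>K\<close>. The kernel
  meets vertex groups trivially, and \<open>K\<langle>z\<rangle>\<close> has finite index while \<open>z\<close> acts trivially on \<open>T\<close>, so \<open>K\<close>
  has finitely many orbits of arcs.

  \<^bold>\<open>Gersten's theorem on a tree.\<close> No free basis is chosen; the argument of Goldstein and Turner is
  carried out on \<open>T\<close> itself. Choose a map \<open>f\<close> on vertices with \<open>f(gx) = \<phi>(g) f(x)\<close>, and let \<open>p\<close> move
  each vertex \<open>x\<close> one step towards \<open>f(x)\<close>. The group \<open>H\<close> of fixed points of \<open>\<phi>\<close> in \<open>K\<close> commutes with
  \<open>f\<close> and hence with \<open>p\<close>. An edge that \<open>p\<close> traverses in neither direction is contained in the path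
  between the \<open>f\<close>-images of its ends, and a cancellation argument shows that there are only finitely
  many such edges modulo \<open>H\<close> (\<open>finitely_generated_fixed_points\<close>). All other edges form the graph of
  the function \<open>p\<close>, whose components have cyclic stabilisers because \<open>H\<close> acts freely; together with
  the finitely many exceptional edges this makes \<open>H\<close> finitely generated
  (\<open>finitely_generated_if_cofinitely_functional\<close>).\<close>


section \<open>Groups mapping to the integers\<close>

lemma (in group) int_hom_mult:
  "\<lbrakk>\<psi> \<in> hom G integer_group; x \<in> carrier G; y \<in> carrier G\<rbrakk> \<Longrightarrow> \<psi> (x \<otimes> y) = \<psi> x + \<psi> y"
  by (simp add: hom_def)

lemma (in group) int_hom_int_pow:
  assumes "\<psi> \<in> hom G integer_group" "x \<in> carrier G"
  shows "\<psi> (x [^] (n::int)) = n * \<psi> x"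
  using hom_int_pow[OF assms(1,2) is_group group_integer_group] by simp

lemma (in group) int_hom_inv:
  assumes "\<psi> \<in> hom G integer_group" "x \<in> carrier G"
  shows "\<psi> (inv x) = - \<psi> x"
  using int_hom_int_pow[OF assms, of "-1"] assms(2) by (simp add: int_pow_neg)

text \<open>Division with remainder: an element on which \<open>\<chi>\<close> takes its least positive value generates the
  group modulo the kernel.\<close>
lemma finitely_generated_by_kernel:
  fixes G (structure)
  assumes G: "group G" and \<chi>: "\<chi> \<in> hom G integer_group"
    and ker: "finitely_generated_group (G\<lparr>carrier := kernel G integer_group \<chi>\<rparr>)"
  shows "finitely_generated_group G"
proof -
  interpret group_hom G integer_group \<chi>
    using G \<chi> by (simp add: group_hom_def group_hom_axioms_def)
  let ?N = "kernel G integer_group \<chi>"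
  obtain S where S: "finite S" "S \<subseteq> ?N" and gen: "generate G S = ?N"
    using ker G.generate_consistent[OF _ subgroup_kernel]
    by (auto simp: finitely_generated_group_def)
  have SG: "S \<subseteq> carrier G"
    using S by (auto simp: kernel_def)
  show ?thesis
  proof (cases "\<exists>x\<in>carrier G. \<chi> x \<noteq> 0")
    case False
    then have "?N = carrier G"
      by (auto simp: kernel_def)
    then show ?thesis
      using S gen G by (auto simp: finitely_generated_group_def)
  next
    case True
    define P where "P = (\<lambda>n. n > 0 \<and> (\<exists>x\<in>carrier G. \<chi> x = int n))"
    obtain x where x: "x \<in> carrier G" "\<chi> x \<noteq> 0"
      using True by blast
    have "\<chi> (inv x) = - \<chi> x"
      using x by simp
    then have "P (nat \<bar>\<chi> x\<bar>)"
      unfolding P_def using x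
      by (cases "\<chi> x > 0") (auto intro: bexI[of _ x] bexI[of _ "inv x"])
    then have "P (LEAST n. P n)" and least: "\<And>n. P n \<Longrightarrow> (LEAST n. P n) \<le> n"
      by (auto intro: LeastI Least_le)
    then obtain d t where d: "d > 0" "t \<in> carrier G" "\<chi> t = int d"
      and least: "\<And>n. P n \<Longrightarrow> d \<le> n"
      unfolding P_def by blast
    have mono: "generate G S \<subseteq> generate G (insert t S)"
      by (rule G.mono_generate) auto
    have "x \<in> generate G (insert t S)" if x: "x \<in> carrier G" for x
    proof -
      define q where "q = \<chi> x div int d"
      define y where "y = x \<otimes> inv (t [^] q)"
      have y: "y \<in> carrier G"
        using x d by (simp add: y_def)
      have "\<chi> (t [^] q) = q * int d"
        using d by (simp add: hom_int_pow)
      then have \<chi>y: "\<chi> y = \<chi> x mod int d"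
        using x d by (simp add: y_def q_def minus_div_mult_eq_mod)
      have "\<chi> y = 0"
      proof (rule ccontr)
        assume "\<chi> y \<noteq> 0"
        moreover have "0 \<le> \<chi> y" "\<chi> y < int d"
          using \<chi>y d by simp_all
        ultimately have "P (nat (\<chi> y))" "nat (\<chi> y) < d"
          unfolding P_def using y by (auto intro: bexI[of _ y])
        then show False
          using least by fastforce
      qed
      then have "y \<in> generate G (insert t S)"
        using y gen mono by (auto simp: kernel_def)
      moreover have "t [^] q \<in> generate G (insert t S)"
        using d SG
        by (intro G.subgroup_int_pow_closed[OF G.generate_is_subgroup] generate.incl) auto
      moreover have "x = y \<otimes> t [^] q"
        using x d by (simp add: y_def G.m_assoc)
      ultimately show ?thesis
        by (metis generate.eng)
    qed
    moreover have "generate G (insert t S) \<subseteq> carrier G"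
      using d SG by (intro G.generate_incl) auto
    ultimately have "generate G (insert t S) = carrier G"
      by blast
    then show ?thesis
      using S SG d G unfolding finitely_generated_group_def
      by (intro conjI exI[of _ "insert t S"]) auto
  qed
qed

lemma finitely_generated_if_inj_int:
  fixes G (structure)
  assumes G: "group G" and \<chi>: "\<chi> \<in> hom G integer_group"
    and inj: "\<And>x. x \<in> carrier G \<Longrightarrow> \<chi> x = 0 \<Longrightarrow> x = \<one>\<^bsub>G\<^esub>"
  shows "finitely_generated_group G"
proof (rule finitely_generated_by_kernel[OF G \<chi>])
  interpret group_hom G integer_group \<chi>
    using G \<chi> by (simp add: group_hom_def group_hom_axioms_def)
  have k: "kernel G integer_group \<chi> = {\<one>\<^bsub>G\<^esub>}"
    using inj by (auto simp: kernel_def)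
  have "group (G\<lparr>carrier := {\<one>\<^bsub>G\<^esub>}\<rparr>)"
    using G.subgroup_imp_group[OF subgroup_kernel] k by simp
  moreover have "generate (G\<lparr>carrier := {\<one>\<^bsub>G\<^esub>}\<rparr>) {} = {\<one>\<^bsub>G\<^esub>}"
    using group.generate_empty[OF calculation] by simp
  ultimately show "finitely_generated_group (G\<lparr>carrier := kernel G integer_group \<chi>\<rparr>)"
    unfolding k finitely_generated_group_def by (intro conjI exI[of _ "{}"]) auto
qed


section \<open>Free actions on functional graphs\<close>

locale free_action = group_action +
  assumes free: "\<lbrakk>g \<in> carrier G; x \<in> E; \<phi> g x = x\<rbrakk> \<Longrightarrow> g = \<one>"

lemma (in group_action) is_group: "group G"
  using group_hom by (simp add: group_hom_def)

lemma (in group_action) act_one: "x \<in> E \<Longrightarrow> \<phi> \<one> x = x"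
  using id_eq_one by (metis restrict_apply')

lemma (in free_action) free_unique:
  assumes "g \<in> carrier G" "h \<in> carrier G" "x \<in> E" "\<phi> g x = \<phi> h x"
  shows "g = h"
proof -
  interpret group G by (rule is_group)
  have "\<phi> (inv h \<otimes> g) x = x"
    using assms orbit_sym_aux[of h x] by (simp add: composition_rule)
  then have "inv h \<otimes> g = \<one>"
    using assms by (intro free) auto
  then show ?thesis
    using assms by (metis inv_closed inv_equality inv_inv)
qed

lemma finitely_generated_if_finite:
  assumes "group G" "finite (carrier G)"
  shows "finitely_generated_group G"
  using assms group.generate_incl[OF assms(1), of "carrier G"] generate.incl[of _ "carrier G" G]
  unfolding finitely_generated_group_def by (intro conjI exI[of _ "carrier G"]) auto

text \<open>Being in the same connected component of the graph with edges from \<open>x\<close> to \<open>p x\<close>.\<close>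
definition merge :: "('a \<Rightarrow> 'a) \<Rightarrow> 'a \<Rightarrow> 'a \<Rightarrow> bool" where
  "merge p x y \<longleftrightarrow> (\<exists>i j. (p ^^ i) x = (p ^^ j) y)"

lemma merge_refl: "merge p x x"
  unfolding merge_def by blast

lemma merge_sym: "merge p x y \<Longrightarrow> merge p y x"
  unfolding merge_def by metis

lemma merge_trans:
  assumes "merge p x y" "merge p y z"
  shows "merge p x z"
proof -
  obtain i j k l where ij: "(p ^^ i) x = (p ^^ j) y" and kl: "(p ^^ k) y = (p ^^ l) z"
    using assms unfolding merge_def by blast
  have "(p ^^ (k + i)) x = (p ^^ k) ((p ^^ j) y)"
    by (simp add: funpow_add ij)
  also have "\<dots> = (p ^^ j) ((p ^^ k) y)"
    by (metis add.commute comp_apply funpow_add)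
  also have "\<dots> = (p ^^ (j + l)) z"
    by (simp add: funpow_add kl)
  finally show ?thesis
    unfolding merge_def by blast
qed

lemma merge_step: "merge p x (p x)"
  unfolding merge_def by (intro exI[of _ 1] exI[of _ 0]) simp

lemma finite_range_funpow:
  fixes p :: "'a \<Rightarrow> 'a"
  assumes "\<not> inj (\<lambda>i. (p ^^ i) x)"
  shows "finite (range (\<lambda>i. (p ^^ i) x))"
proof -
  obtain a b where ab: "a < b" "(p ^^ a) x = (p ^^ b) x"
  proof -
    obtain a b where "a \<noteq> b" "(p ^^ a) x = (p ^^ b) x"
      using assms by (auto simp: inj_def)
    then show ?thesis
      using that[of a b] that[of b a] by (cases "a < b") auto
  qed
  have "(p ^^ i) x \<in> (\<lambda>i. (p ^^ i) x) ` {..<b}" for i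
  proof (induction i rule: less_induct)
    case (less i)
    show ?case
    proof (cases "i < b")
      case False
      then have "(p ^^ i) x = (p ^^ (i - b)) ((p ^^ b) x)"
        using funpow_add[of "i - b" b p] by simp
      also have "\<dots> = (p ^^ (i - b + a)) x"
        by (simp add: ab funpow_add)
      finally show ?thesis
        using less[of "i - b + a"] ab False by simp
    qed auto
  qed
  then have "range (\<lambda>i. (p ^^ i) x) \<subseteq> (\<lambda>i. (p ^^ i) x) ` {..<b}"
    by blast
  then show ?thesis
    by (rule finite_subset) simp
qed

locale free_functional_action = free_action +
  fixes p
  assumes p_closed: "x \<in> E \<Longrightarrow> p x \<in> E"
    and p_equivariant: "\<lbrakk>g \<in> carrier G; x \<in> E\<rbrakk> \<Longrightarrow> p (\<phi> g x) = \<phi> g (p x)"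
begin

sublocale group G by (rule is_group)

lemma funpow_closed: "x \<in> E \<Longrightarrow> (p ^^ i) x \<in> E"
  by (induction i) (auto intro: p_closed)

lemma funpow_equivariant:
  "\<lbrakk>g \<in> carrier G; x \<in> E\<rbrakk> \<Longrightarrow> (p ^^ i) (\<phi> g x) = \<phi> g ((p ^^ i) x)"
  by (induction i) (auto simp: p_equivariant funpow_closed)

lemma merge_act:
  "\<lbrakk>merge p x y; g \<in> carrier G; x \<in> E; y \<in> E\<rbrakk> \<Longrightarrow> merge p (\<phi> g x) (\<phi> g y)"
  unfolding merge_def by (metis funpow_equivariant)

lemma act_closed: "\<lbrakk>g \<in> carrier G; x \<in> E\<rbrakk> \<Longrightarrow> \<phi> g x \<in> E"
  using element_image by blast

lemma act_inv: "\<lbrakk>g \<in> carrier G; x \<in> E\<rbrakk> \<Longrightarrow> \<phi> (inv g) (\<phi> g x) = x"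
  using orbit_sym_aux by blast

text \<open>The elements that carry the component of \<open>y\<close> onto that of \<open>x\<close>; in particular
  \<open>mergers x x\<close> is the stabiliser of the component of \<open>x\<close>.\<close>
definition mergers :: "'c \<Rightarrow> 'c \<Rightarrow> 'a set" where
  "mergers x y = {g \<in> carrier G. merge p x (\<phi> g y)}"

lemma mergers_mult_inv:
  assumes "x \<in> E" "y \<in> E" "g \<in> mergers x y" "h \<in> mergers x y"
  shows "g \<otimes> inv h \<in> mergers x x"
proof -
  have g: "g \<in> carrier G" "merge p x (\<phi> g y)" and h: "h \<in> carrier G" "merge p x (\<phi> h y)"
    using assms by (auto simp: mergers_def)
  have "merge p (\<phi> (g \<otimes> inv h) x) (\<phi> (g \<otimes> inv h) (\<phi> h y))"
    using g h assms by (intro merge_act) (auto intro: act_closed)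
  also have "\<phi> (g \<otimes> inv h) (\<phi> h y) = \<phi> g y"
    using g h assms by (simp add: composition_rule act_closed act_inv)
  finally have "merge p x (\<phi> (g \<otimes> inv h) x)"
    using g merge_trans merge_sym by metis
  then show ?thesis
    using g h by (simp add: mergers_def)
qed

lemma subgroup_mergers:
  assumes "x \<in> E"
  shows "subgroup (mergers x x) G"
proof -
  have one: "\<one> \<in> mergers x x"
    using assms by (simp add: mergers_def act_one merge_refl)
  have inv: "inv g \<in> mergers x x" if "g \<in> mergers x x" for g
    using mergers_mult_inv[OF assms assms one that] that by (simp add: mergers_def)
  have "g \<otimes> h \<in> mergers x x" if "g \<in> mergers x x" "h \<in> mergers x x" for g h
    using mergers_mult_inv[OF assms assms that(1) inv[OF that(2)]] that by (simp add: mergers_def)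
  then show ?thesis
    using one inv by unfold_locales (auto simp: mergers_def)
qed

lemma mergersD:
  assumes "x \<in> E" "g \<in> mergers x x"
  shows "\<exists>i j. (p ^^ i) x = \<phi> g ((p ^^ j) x)"
proof -
  obtain i j where "(p ^^ i) x = (p ^^ j) (\<phi> g x)" "g \<in> carrier G"
    using assms by (auto simp: mergers_def merge_def)
  then have "(p ^^ i) x = \<phi> g ((p ^^ j) x)"
    using assms by (simp add: funpow_equivariant)
  then show ?thesis
    by blast
qed

text \<open>If the forward orbit of \<open>x\<close> under \<open>p\<close> is finite, then every element of the stabiliser maps some
  point of this finite set to another one, and by freeness there are only finitely many such elements.
  If it is infinite, then \<open>p\<^sup>i x = g (p\<^sup>j x)\<close> determines \<open>i - j\<close>, and this translation length embeds
  the stabiliser into the integers.\<close>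
lemma finitely_generated_mergers:
  assumes x: "x \<in> E"
  shows "finitely_generated_group (G\<lparr>carrier := mergers x x\<rparr>)"
proof (cases "inj (\<lambda>i. (p ^^ i) x)")
  case False
  let ?O = "range (\<lambda>i. (p ^^ i) x)"
  have "mergers x x \<subseteq> (\<Union>y\<in>?O. \<Union>z\<in>?O. {g \<in> carrier G. \<phi> g y = z})"
  proof
    fix g assume g: "g \<in> mergers x x"
    then obtain i j where "(p ^^ i) x = \<phi> g ((p ^^ j) x)"
      using mergersD[OF x] by blast
    then have "g \<in> {g \<in> carrier G. \<phi> g ((p ^^ j) x) = (p ^^ i) x}"
      using g by (simp add: mergers_def)
    then show "g \<in> (\<Union>y\<in>?O. \<Union>z\<in>?O. {g \<in> carrier G. \<phi> g y = z})"
      by blast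
  qed
  moreover have "finite {g \<in> carrier G. \<phi> g y = z}" if "y \<in> ?O" for y z
  proof -
    have "y \<in> E"
      using that x funpow_closed by auto
    then have "{g \<in> carrier G. \<phi> g y = z} \<subseteq> {g}" if "g \<in> carrier G" "\<phi> g y = z" for g
      using that free_unique by blast
    then show ?thesis
      by (cases "{g \<in> carrier G. \<phi> g y = z} = {}") (auto intro: finite_subset)
  qed
  then have "finite (\<Union>y\<in>?O. \<Union>z\<in>?O. {g \<in> carrier G. \<phi> g y = z})"
    by (intro finite_UN_I[OF finite_range_funpow[OF False]])
  ultimately have "finite (mergers x x)"
    by (rule finite_subset)
  then show ?thesis
    using subgroup_imp_group[OF subgroup_mergers[OF x]]
    by (intro finitely_generated_if_finite) auto
next
  case inj: True
  define \<delta> where "\<delta> g = (SOME d. \<exists>i j. (p ^^ i) x = \<phi> g ((p ^^ j) x) \<and> d = int i - int j)" for g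
  have \<delta>: "\<delta> g = int i - int j"
    if g: "g \<in> carrier G" and ij: "(p ^^ i) x = \<phi> g ((p ^^ j) x)" for g i j
  proof -
    have "\<exists>d i j. (p ^^ i) x = \<phi> g ((p ^^ j) x) \<and> d = int i - int j"
      using ij by blast
    then have "\<exists>i j. (p ^^ i) x = \<phi> g ((p ^^ j) x) \<and> \<delta> g = int i - int j"
      unfolding \<delta>_def by (rule someI_ex)
    then obtain k l where kl: "(p ^^ k) x = \<phi> g ((p ^^ l) x)" "\<delta> g = int k - int l"
      by blast
    have "(p ^^ (l + i)) x = \<phi> g ((p ^^ (l + j)) x)"
      using g x ij by (simp add: funpow_add funpow_equivariant funpow_closed)
    moreover have "(p ^^ (j + k)) x = \<phi> g ((p ^^ (j + l)) x)"
      using g x kl by (simp add: funpow_add funpow_equivariant funpow_closed)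
    ultimately have "(p ^^ (l + i)) x = (p ^^ (j + k)) x"
      by (simp add: add.commute)
    then have "l + i = j + k"
      using inj by (auto dest: injD)
    then show ?thesis
      using kl by linarith
  qed
  show ?thesis
  proof (rule finitely_generated_if_inj_int)
    show "group (G\<lparr>carrier := mergers x x\<rparr>)"
      by (rule subgroup_imp_group[OF subgroup_mergers[OF x]])
    show "\<delta> \<in> hom (G\<lparr>carrier := mergers x x\<rparr>) integer_group"
    proof (rule homI)
      fix g h assume "g \<in> carrier (G\<lparr>carrier := mergers x x\<rparr>)" "h \<in> carrier (G\<lparr>carrier := mergers x x\<rparr>)"
      then have g: "g \<in> mergers x x" and h: "h \<in> mergers x x"
        by auto
      then have G: "g \<in> carrier G" "h \<in> carrier G"
        by (auto simp: mergers_def)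
      obtain i j where ij: "(p ^^ i) x = \<phi> g ((p ^^ j) x)"
        using mergersD[OF x] g by blast
      obtain k l where kl: "(p ^^ k) x = \<phi> h ((p ^^ l) x)"
        using mergersD[OF x] h by blast
      have "(p ^^ (k + i)) x = (p ^^ k) (\<phi> g ((p ^^ j) x))"
        by (simp add: funpow_add ij)
      also have "\<dots> = \<phi> g ((p ^^ j) ((p ^^ k) x))"
        using G x by (simp add: funpow_equivariant funpow_closed)
          (metis add.commute comp_apply funpow_add)
      also have "\<dots> = \<phi> (g \<otimes> h) ((p ^^ (j + l)) x)"
        using G x by (simp add: kl funpow_equivariant funpow_closed composition_rule funpow_add)
      finally have "\<delta> (g \<otimes> h) = int (k + i) - int (j + l)"
        using G by (intro \<delta>) auto
      then show "\<delta> (g \<otimes>\<^bsub>G\<lparr>carrier := mergers x x\<rparr>\<^esub> h) = \<delta> g \<otimes>\<^bsub>integer_group\<^esub> \<delta> h"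
        using \<delta>[OF G(1) ij] \<delta>[OF G(2) kl] by simp
    qed simp
  next
    fix g assume "g \<in> carrier (G\<lparr>carrier := mergers x x\<rparr>)" and 0: "\<delta> g = 0"
    then have g: "g \<in> carrier G" "g \<in> mergers x x"
      by (auto simp: mergers_def)
    then obtain i j where ij: "(p ^^ i) x = \<phi> g ((p ^^ j) x)"
      using mergersD[OF x] by blast
    then have "i = j"
      using \<delta>[OF g(1) ij] 0 by simp
    then show "g = \<one>\<^bsub>G\<lparr>carrier := mergers x x\<rparr>\<^esub>"
      using free[OF g(1) funpow_closed[OF x, of i]] ij by simp
  qed
qed

text \<open>Let \<open>S\<close> consist of \<open>v0\<close> and the ends of the exceptional edges in \<open>D\<close>. For each pair of points of
  \<open>S\<close> whose components are in the same orbit choose one element relating these components; with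
  generators of the component stabilisers these elements generate a subgroup \<open>M\<close>. Walking from \<open>v0\<close>
  along the connected graph one stays in the \<open>M\<close>-translates of the components that meet \<open>S\<close>: the
  edges given by \<open>p\<close> do not leave a component, and a translate by \<open>g\<close> of an edge in \<open>D\<close> can only be
  used if \<open>g \<in> M\<close>.\<close>
theorem finitely_generated_if_cofinitely_functional:
  assumes D: "finite D" "D \<subseteq> E \<times> E" and v0: "v0 \<in> E"
    and reach: "\<And>x. x \<in> E \<Longrightarrow>
      (v0, x) \<in> ({(x, y). x \<in> E \<and> y \<in> E \<and> (y = p x \<or> x = p y)} \<union>
        {(\<phi> g x, \<phi> g y) | g x y. g \<in> carrier G \<and> (x, y) \<in> D})\<^sup>*"
  shows "finitely_generated_group G"
proof -
  define S where "S = insert v0 (fst ` D \<union> snd ` D)"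
  have S: "finite S" "S \<subseteq> E"
    using D v0 by (auto simp: S_def)
  have "\<exists>A. finite A \<and> A \<subseteq> mergers s s \<and> generate G A = mergers s s" if "s \<in> S" for s
  proof -
    have s: "s \<in> E"
      using that S by blast
    obtain A where "finite A" "A \<subseteq> mergers s s" "generate (G\<lparr>carrier := mergers s s\<rparr>) A = mergers s s"
      using finitely_generated_mergers[OF s] by (auto simp: finitely_generated_group_def)
    then show ?thesis
      using generate_consistent[OF _ subgroup_mergers[OF s]] by blast
  qed
  then obtain A where A: "\<And>s. s \<in> S \<Longrightarrow> finite (A s) \<and> A s \<subseteq> mergers s s \<and> generate G (A s) = mergers s s"
    by metis
  define b where "b s t = (if mergers s t = {} then \<one> else SOME g. g \<in> mergers s t)" for s t
  have b: "b s t \<in> mergers s t" if "mergers s t \<noteq> {}" for s t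
    using that unfolding b_def by (auto intro: someI)
  have bG: "b s t \<in> carrier G" for s t
    using b[of s t] by (cases "mergers s t = {}") (auto simp: b_def mergers_def)
  define W where "W = (\<Union>s\<in>S. A s) \<union> (\<lambda>(s, t). b s t) ` (S \<times> S)"
  have W: "finite W" "W \<subseteq> carrier G"
    using S A bG by (auto simp: W_def mergers_def)
  define M where "M = generate G W"
  have M: "subgroup M G"
    unfolding M_def by (rule generate_is_subgroup[OF W(2)])
  have mergers_M: "mergers s t \<subseteq> M" if st: "s \<in> S" "t \<in> S" for s t
  proof
    fix g assume g: "g \<in> mergers s t"
    have "mergers s s = generate G (A s)"
      using A st by simp
    also have "\<dots> \<subseteq> M"
      unfolding M_def W_def using st by (intro mono_generate) blast
    finally have "g \<otimes> inv (b s t) \<in> M"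
      using mergers_mult_inv[of s t g "b s t"] g b[of s t] st S by blast
    moreover have "b s t \<in> M"
      unfolding M_def W_def using st by (intro generate.incl) auto
    ultimately have "g \<otimes> inv (b s t) \<otimes> b s t \<in> M"
      using M subgroup.m_closed by metis
    then show "g \<in> M"
      using g bG by (simp add: mergers_def m_assoc)
  qed
  have reach_M: "x \<in> E \<and> (\<exists>c\<in>M. \<exists>s\<in>S. merge p x (\<phi> c s))"
    if "(v0, x) \<in> ({(x, y). x \<in> E \<and> y \<in> E \<and> (y = p x \<or> x = p y)} \<union>
        {(\<phi> g x, \<phi> g y) | g x y. g \<in> carrier G \<and> (x, y) \<in> D})\<^sup>*" for x
    using that
  proof (induction rule: rtrancl_induct)
    case base
    then show ?case
      using v0 subgroup.one_closed[OF M] by (auto simp: S_def act_one intro!: bexI[of _ \<one>] merge_refl)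
  next
    case (step x y)
    obtain c s where c: "c \<in> M" "s \<in> S" "merge p x (\<phi> c s)" and x: "x \<in> E"
      using step.IH by blast
    have cG: "c \<in> carrier G"
      using c M subgroup.mem_carrier by metis
    from step.hyps(2) consider "y \<in> E" "y = p x \<or> x = p y"
      | g s' t where "g \<in> carrier G" "(s', t) \<in> D" "x = \<phi> g s'" "y = \<phi> g t"
      by blast
    then show ?case
    proof cases
      case 1
      then have "merge p y x"
        using merge_step merge_sym by metis
      then have "merge p y (\<phi> c s)"
        using c(3) by (rule merge_trans)
      then show ?thesis
        using c(1,2) \<open>y \<in> E\<close> by blast
    next
      case 2
      then have S': "s' \<in> S" "t \<in> S"
        by (force simp: S_def)+
      then have E: "s \<in> E" "s' \<in> E" "t \<in> E"
        using S c by auto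
      have "merge p (\<phi> (inv c) (\<phi> c s)) (\<phi> (inv c) (\<phi> g s'))"
        using c cG 2 E by (intro merge_act) (auto intro: act_closed merge_sym)
      then have "inv c \<otimes> g \<in> mergers s s'"
        using cG 2 E by (simp add: mergers_def act_inv composition_rule)
      then have "c \<otimes> (inv c \<otimes> g) \<in> M"
        using mergers_M[OF c(2) S'(1)] c(1) M by (auto intro: subgroup.m_closed)
      then have "g \<in> M"
        using cG 2 by (simp add: m_assoc[symmetric])
      moreover have "y \<in> E"
        using 2 E by (simp add: act_closed)
      ultimately show ?thesis
        using 2(4) S'(2) merge_refl[of p "\<phi> g t"] by blast
    qed
  qed
  have "g \<in> M" if g: "g \<in> carrier G" for g
  proof -
    obtain c s where c: "c \<in> M" "s \<in> S" "merge p (\<phi> g v0) (\<phi> c s)"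
      using reach_M[OF reach[OF act_closed[OF g v0]]] by blast
    have cG: "c \<in> carrier G" and s: "s \<in> E"
      using c M S subgroup.mem_carrier by (metis, auto)
    have "merge p (\<phi> (inv c) (\<phi> c s)) (\<phi> (inv c) (\<phi> g v0))"
      using c cG s g v0 by (intro merge_act) (auto intro: act_closed merge_sym)
    then have "inv c \<otimes> g \<in> mergers s v0"
      using cG s g v0 by (simp add: mergers_def act_inv composition_rule)
    then have "c \<otimes> (inv c \<otimes> g) \<in> M"
      using mergers_M[OF c(2), of v0] c(1) M by (auto simp: S_def intro: subgroup.m_closed)
    then show ?thesis
      using cG g by (simp add: m_assoc[symmetric])
  qed
  then have "generate G W = carrier G"
    using M subgroup.subset unfolding M_def by blast
  then show ?thesis
    using W is_group unfolding finitely_generated_group_def by blast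
qed

end


section \<open>Sides of edges in trees\<close>

locale serre_tree = bidirected_digraph X arev for X :: "('v, 'e) pre_digraph" and arev +
  assumes is_tree: "bidirected_tree X arev"
begin

lemma connected_ends: "x \<in> verts X \<Longrightarrow> y \<in> verts X \<Longrightarrow> (x, y) \<in> (arcs_ends X)\<^sup>*"
  using is_tree by (auto simp: bidirected_tree_def strongly_connected_def reachable_conv)

lemma connected_induct [consumes 2, case_names base step]:
  assumes "x \<in> verts X" "y \<in> verts X" "P x"
    and step: "\<And>a. a \<in> arcs X \<Longrightarrow> P (tail X a) \<Longrightarrow> P (head X a)"
  shows "P y"
  using connected_ends[OF assms(1,2)]
  by (induction rule: rtrancl_induct) (auto simp: assms(3) arcs_ends_def arc_to_ends_def intro: step)

definition avoiding :: "'e \<Rightarrow> 'v rel" where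
  "avoiding a = {(tail X b, head X b) | b. b \<in> arcs X \<and> b \<noteq> a \<and> b \<noteq> arev a}"

text \<open>The half of the tree at the head of the arc \<open>a\<close>, left after removing the edge that carries \<open>a\<close>.\<close>
definition side :: "'e \<Rightarrow> 'v set" where
  "side a = {x. (head X a, x) \<in> (avoiding a)\<^sup>*}"

lemma avoiding_arev: "avoiding (arev a) = avoiding a"
  unfolding avoiding_def by auto

lemma sym_avoiding: "sym ((avoiding a)\<^sup>*)"
proof (rule sym_rtrancl, rule symI)
  fix x y assume "(x, y) \<in> avoiding a"
  then obtain b where "b \<in> arcs X" "b \<noteq> a" "b \<noteq> arev a" "x = tail X b" "y = head X b"
    by (auto simp: avoiding_def)
  then have "arev b \<in> arcs X \<and> arev b \<noteq> a \<and> arev b \<noteq> arev a \<and> y = tail X (arev b) \<and> x = head X (arev b)"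
    by (metis arev_arev arev_in_arcs head_arev tail_arev)
  then show "(y, x) \<in> avoiding a"
    unfolding avoiding_def by blast
qed

lemma head_in_side: "head X a \<in> side a"
  by (simp add: side_def)

lemma side_step:
  assumes "b \<in> arcs X" "b \<noteq> a" "b \<noteq> arev a"
  shows "tail X b \<in> side a \<longleftrightarrow> head X b \<in> side a"
proof -
  have "(tail X b, head X b) \<in> (avoiding a)\<^sup>*"
    using assms unfolding avoiding_def by blast
  then show ?thesis
    unfolding side_def using sym_avoiding by (metis mem_Collect_eq rtrancl_trans symD)
qed

lemma apath_no_backtracking: "apath u p v \<Longrightarrow> successively (\<lambda>a b. b \<noteq> arev a) p"
proof (induction p arbitrary: u)
  case (Cons a p)
  then show ?case
    by (cases p) (auto simp: apath_Cons_iff dest: hd_in_awalk_verts)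
qed simp

text \<open>Otherwise a path from the head back to the tail that avoids the edge closes up to a circuit.\<close>
lemma tail_notin_side:
  assumes a: "a \<in> arcs X"
  shows "tail X a \<notin> side a"
proof
  assume "tail X a \<in> side a"
  then have "(head X a, tail X a) \<in> (avoiding a)\<^sup>*"
    by (simp add: side_def)
  then have "\<exists>p. awalk (head X a) p (tail X a) \<and> set p \<subseteq> arcs X - {a, arev a}"
  proof (induction rule: rtrancl_induct)
    case base
    then show ?case
      using a by (intro exI[of _ "[]"]) (auto simp: awalk_Nil_iff)
  next
    case (step y z)
    then obtain p b where "awalk (head X a) p y" "set p \<subseteq> arcs X - {a, arev a}"
      "b \<in> arcs X" "b \<noteq> a" "b \<noteq> arev a" "y = tail X b" "z = head X b"
      by (auto simp: avoiding_def)
    then show ?case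
      by (intro exI[of _ "p @ [b]"]) (auto simp: awalk_simps awalk_append_iff)
  qed
  then obtain p where p: "apath (head X a) p (tail X a)" "set p \<subseteq> arcs X - {a, arev a}"
    using apath_awalk_to_apath awalk_to_apath_subset by (metis subset_trans)
  have "awalk (tail X a) (a # p) (tail X a)" "distinct (tl (awalk_verts (tail X a) (a # p)))"
    using a p by (auto simp: awalk_Cons_iff apath_def)
  then have "cycle (a # p)"
    unfolding cycle_def by blast
  moreover have "successively (\<lambda>a b. b \<noteq> arev a) (a # p)"
    using apath_no_backtracking[OF p(1)] p(2) by (cases p) auto
  ultimately show False
    using is_tree by (auto simp: bidirected_tree_def circuit_def)
qed

lemma side_arev_iff:
  assumes a: "a \<in> arcs X" and x: "x \<in> verts X"
  shows "x \<in> side (arev a) \<longleftrightarrow> x \<notin> side a"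
proof
  assume "x \<in> side (arev a)"
  then have "(tail X a, x) \<in> (avoiding a)\<^sup>*"
    using a by (simp add: side_def avoiding_arev)
  then show "x \<notin> side a"
    using tail_notin_side[OF a] sym_avoiding unfolding side_def
    by (metis mem_Collect_eq rtrancl_trans symD)
next
  have "x \<in> side a \<or> x \<in> side (arev a)"
    using head_in_verts[OF a] x
  proof (induction rule: connected_induct)
    case base
    then show ?case by (simp add: head_in_side)
  next
    case (step b)
    then show ?case
      using side_step[of b a] side_step[of b "arev a"] head_in_side[of a] head_in_side[of "arev a"]
      by (cases "b = a \<or> b = arev a") auto
  qed
  then show "x \<notin> side a \<Longrightarrow> x \<in> side (arev a)"
    by blast
qed

text \<open>Two different arcs leaving the same vertex lead into disjoint parts of the tree; so the step from
  a vertex towards another one is unique. A walk inside \<open>side b\<close> never uses \<open>a\<close>, because this would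
  take it to the tail of \<open>b\<close>.\<close>
lemma side_unique:
  assumes a: "a \<in> arcs X" and b: "b \<in> arcs X" and tails: "tail X a = tail X b"
    and x: "x \<in> side a" "x \<in> side b" "x \<in> verts X"
  shows "a = b"
proof (rule ccontr)
  assume ne: "a \<noteq> b"
  have ne': "b \<noteq> arev a"
    using side_arev_iff[OF a] x by blast
  have "head X b \<in> side (arev a)"
    using side_step[of b "arev a"] head_in_side[of "arev a"] a b ne ne' tails by auto
  moreover have "(head X b, x) \<in> (avoiding b)\<^sup>*"
    using x by (simp add: side_def)
  then have "x \<in> side b \<and> (head X b \<in> side (arev a) \<longrightarrow> x \<in> side (arev a))"
  proof (induction rule: rtrancl_induct)
    case base
    then show ?case by (simp add: head_in_side)
  next
    case (step y z)
    then obtain c where c: "c \<in> arcs X" "c \<noteq> b" "c \<noteq> arev b" "y = tail X c" "z = head X c"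
      by (auto simp: avoiding_def)
    then have "z \<in> side b"
      using side_step step by blast
    moreover from this have "c \<noteq> a" "c \<noteq> arev a"
      using c step tail_notin_side[OF b] tails a by auto
    then have "y \<in> side (arev a) \<longleftrightarrow> z \<in> side (arev a)"
      using side_step[of c "arev a"] c by simp
    ultimately show ?case
      using step by blast
  qed
  ultimately show False
    using side_arev_iff[OF a] x by blast
qed

lemma walk_crosses:
  assumes "awalk x p y" "x \<notin> side a" "y \<in> side a"
  shows "a \<in> set p \<or> arev a \<in> set p"
  using assms
proof (induction p arbitrary: x)
  case (Cons b p)
  then show ?case
    using side_step[of b a] by (cases "b = a \<or> b = arev a") (auto simp: awalk_Cons_iff)
qed (auto simp: awalk_Nil_iff)

text \<open>The potential of \<open>y\<close> is the sum of \<open>t\<close> over the finitely many arcs that separate a base point \<open>x\<close>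
  from \<open>y\<close>. Moving \<open>y\<close> along an arc \<open>b\<close> changes this set by \<open>b\<close> or \<open>arev b\<close> only.\<close>
lemma exists_potential:
  fixes t :: "'e \<Rightarrow> 'c :: ab_group_add"
  assumes t: "\<And>a. a \<in> arcs X \<Longrightarrow> t (arev a) = - t a"
  shows "\<exists>u. \<forall>a\<in>arcs X. u (head X a) = u (tail X a) + t a"
proof -
  obtain x where x: "x \<in> verts X"
    using is_tree by (auto simp: bidirected_tree_def strongly_connected_def)
  define sep where "sep y = {a \<in> arcs X. x \<notin> side a \<and> y \<in> side a}" for y
  have sep_step: "sep (head X b) = insert b (sep (tail X b)) \<and> b \<notin> sep (tail X b)"
    if b: "b \<in> arcs X" and xb: "x \<notin> side b" for b
  proof -
    have "x \<in> side (arev b)"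
      using side_arev_iff[OF b x] xb by simp
    moreover have "a \<in> sep (head X b) \<longleftrightarrow> a \<in> sep (tail X b)" if "a \<noteq> b" "a \<noteq> arev b" for a
    proof -
      have "b \<noteq> arev a"
        using that by auto
      then show ?thesis
        using side_step[of b a] b that by (auto simp: sep_def)
    qed
    moreover have "b \<in> sep (head X b)" "b \<notin> sep (tail X b)"
      using b xb tail_notin_side[OF b] head_in_side[of b] by (auto simp: sep_def)
    moreover have "arev b \<notin> sep (head X b)" "arev b \<notin> sep (tail X b)"
      using \<open>x \<in> side (arev b)\<close> by (auto simp: sep_def)
    ultimately have "a \<in> sep (head X b) \<longleftrightarrow> a = b \<or> a \<in> sep (tail X b)" for a
      by (cases "a = b"; cases "a = arev b") auto
    then show ?thesis
      using \<open>b \<notin> sep (tail X b)\<close> by auto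
  qed
  have step': "sep (tail X b) = insert (arev b) (sep (head X b)) \<and> arev b \<notin> sep (head X b)"
    if b: "b \<in> arcs X" and "x \<in> side b" for b
    using sep_step[of "arev b"] side_arev_iff[OF b x] that by simp
  have fin: "finite (sep y)" if "y \<in> verts X" for y
    using x that
  proof (induction rule: connected_induct)
    case base
    then show ?case by (simp add: sep_def)
  next
    case (step b)
    then show ?case
      using sep_step[of b] step'[of b] by (cases "x \<in> side b") auto
  qed
  have "sum t (sep (head X b)) = sum t (sep (tail X b)) + t b" if b: "b \<in> arcs X" for b
  proof (cases "x \<in> side b")
    case True
    then show ?thesis
      using step'[OF b] fin b by (simp add: t)
  next
    case False
    then show ?thesis
      using sep_step[OF b] fin b by (simp add: add.commute)
  qed
  then show ?thesis
    by (intro exI[of _ "\<lambda>y. sum t (sep y)"]) blast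
qed

end

locale tree_action = graph_action G X arev \<alpha> \<beta> + serre_tree X arev
  for G (structure) and X :: "('v, 'e) pre_digraph" and arev \<alpha> \<beta>
begin

sublocale group G by (rule on_verts.is_group)

lemma act_verts: "\<lbrakk>g \<in> carrier G; x \<in> verts X\<rbrakk> \<Longrightarrow> \<alpha> g x \<in> verts X"
  using on_verts.element_image by blast

lemma act_arcs: "\<lbrakk>g \<in> carrier G; a \<in> arcs X\<rbrakk> \<Longrightarrow> \<beta> g a \<in> arcs X"
  using on_arcs.element_image by blast

lemma act_inv_verts:
  assumes "g \<in> carrier G" "x \<in> verts X"
  shows "\<alpha> (inv g) (\<alpha> g x) = x" "\<alpha> g (\<alpha> (inv g) x) = x"
  using on_verts.orbit_sym_aux assms by (blast, metis inv_closed inv_inv)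

lemma act_inv_arcs:
  assumes "g \<in> carrier G" "a \<in> arcs X"
  shows "\<beta> (inv g) (\<beta> g a) = a" "\<beta> g (\<beta> (inv g) a) = a"
  using on_arcs.orbit_sym_aux assms by (blast, metis inv_closed inv_inv)

lemma side_equivariant:
  assumes g: "g \<in> carrier G" and a: "a \<in> arcs X" and x: "x \<in> side a"
  shows "\<alpha> g x \<in> side (\<beta> g a)"
proof -
  have "(head X a, x) \<in> (avoiding a)\<^sup>*"
    using x by (simp add: side_def)
  then show ?thesis
  proof (induction rule: rtrancl_induct)
    case base
    then show ?case
      using head_in_side[of "\<beta> g a"] g a by (simp add: head_equivariant)
  next
    case (step y z)
    then obtain b where b: "b \<in> arcs X" "b \<noteq> a" "b \<noteq> arev a" "y = tail X b" "z = head X b"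
      by (auto simp: avoiding_def)
    then have "\<beta> g b \<noteq> \<beta> g a" "\<beta> g b \<noteq> arev (\<beta> g a)"
      using on_arcs.inj_prop[OF g] g a by (auto simp flip: rev_equivariant dest: inj_onD)
    then show ?case
      using side_step[of "\<beta> g b" "\<beta> g a"] step b g a
      by (simp add: act_arcs tail_equivariant head_equivariant)
  qed
qed

end


section \<open>Fixed points of endomorphisms of groups acting freely on trees\<close>

lemma (in group) subgroup_fixed_points_hom:
  assumes "\<phi> \<in> hom G G"
  shows "subgroup (fixed_points G \<phi>) G"
proof -
  interpret h: group_hom G G \<phi>
    using assms by unfold_locales
  show ?thesis
    by unfold_locales (auto simp: fixed_points_def)
qed

lemma (in group_action) subgroup_action_on:
  assumes "subgroup H G"
  shows "group_action (G\<lparr>carrier := H\<rparr>) E \<phi>"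
  using assms group_hom is_group unfolding group_action_def group_hom_def group_hom_axioms_def
  by (auto simp: hom_def subgroup.subset[THEN subsetD] group.subgroup_imp_group)

lemma (in group_action) orbit_act:
  assumes g: "g \<in> carrier G" and x: "x \<in> E"
  shows "orbit G \<phi> (\<phi> g x) = orbit G \<phi> x"
proof -
  interpret group G by (rule is_group)
  show ?thesis
  proof
    show "orbit G \<phi> (\<phi> g x) \<subseteq> orbit G \<phi> x"
      using x g by (auto simp: orbit_def composition_rule[symmetric])
    have "\<phi> h x = \<phi> (h \<otimes> inv g) (\<phi> g x)" if "h \<in> carrier G" for h
      using x g that element_image[OF g x] orbit_sym_aux[OF g x] by (simp add: composition_rule)
    moreover have "h \<otimes> inv g \<in> carrier G" if "h \<in> carrier G" for h
      using g that by simp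
    ultimately show "orbit G \<phi> x \<subseteq> orbit G \<phi> (\<phi> g x)"
      unfolding orbit_def by blast
  qed
qed

lemma (in group_action) orbit_eqD:
  assumes "x \<in> E" "y \<in> E" "orbit G \<phi> x = orbit G \<phi> y"
  shows "\<exists>g\<in>carrier G. x = \<phi> g y"
  using orbit_refl[OF assms(1)] assms(3) by (auto simp: orbit_def)

locale free_tree_action = tree_action +
  assumes free_on_verts: "\<lbrakk>g \<in> carrier G; x \<in> verts X; \<alpha> g x = x\<rbrakk> \<Longrightarrow> g = \<one>"
begin

sublocale verts: free_action G "verts X" \<alpha>
  by unfold_locales (rule free_on_verts)

lemma free_on_arcs:
  assumes "g \<in> carrier G" "h \<in> carrier G" "a \<in> arcs X" "\<beta> g a = \<beta> h a"
  shows "g = h"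
  using assms verts.free_unique[of g h "tail X a"] tail_equivariant by (metis tail_in_verts)

text \<open>The map can be prescribed on orbit representatives; freeness makes the extension well defined.\<close>
lemma exists_twisted_equivariant_map:
  assumes \<phi>: "\<phi> \<in> hom G G"
  shows "\<exists>f. \<forall>x\<in>verts X. f x \<in> verts X \<and> (\<forall>g\<in>carrier G. f (\<alpha> g x) = \<alpha> (\<phi> g) (f x))"
proof -
  have \<phi>G: "\<And>g. g \<in> carrier G \<Longrightarrow> \<phi> g \<in> carrier G"
    using \<phi> by (auto simp: hom_def)
  define r where "r x = (SOME y. y \<in> orbit G \<alpha> x)" for x
  have r: "r x \<in> orbit G \<alpha> x" if "x \<in> verts X" for x
    unfolding r_def using on_verts.orbit_refl[OF that] by (rule someI)
  then have rV: "r x \<in> verts X" if "x \<in> verts X" for x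
    using that act_verts by (force simp: orbit_def)
  have "\<exists>g\<in>carrier G. \<alpha> g (r x) = x" if x: "x \<in> verts X" for x
    using on_verts.orbit_sym[OF x rV[OF x] r[OF x]] by (force simp: orbit_def)
  then obtain k where k: "\<And>x. x \<in> verts X \<Longrightarrow> k x \<in> carrier G \<and> \<alpha> (k x) (r x) = x"
    by metis
  have "\<alpha> (\<phi> (k (\<alpha> g x))) (r (\<alpha> g x)) = \<alpha> (\<phi> g) (\<alpha> (\<phi> (k x)) (r x))"
    if x: "x \<in> verts X" and g: "g \<in> carrier G" for x g
  proof -
    have gx: "\<alpha> g x \<in> verts X"
      using x g by (rule act_verts[rotated])
    have rg: "r (\<alpha> g x) = r x"
      using x g by (simp add: r_def on_verts.orbit_act)
    have "\<alpha> (k (\<alpha> g x)) (r x) = \<alpha> (g \<otimes> k x) (r x)"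
      using k[OF x] k[OF gx] rg g rV[OF x] by (simp add: on_verts.composition_rule)
    then have "k (\<alpha> g x) = g \<otimes> k x"
      using k[OF x] k[OF gx] g rV[OF x] by (intro verts.free_unique) auto
    then show ?thesis
      using rg g k[OF x] rV[OF x] \<phi>G \<phi> by (simp add: hom_mult on_verts.composition_rule)
  qed
  then show ?thesis
    using rV k \<phi>G act_verts by (intro exI[of _ "\<lambda>x. \<alpha> (\<phi> (k x)) (r x)"]) blast
qed

text \<open>The theorem of Gersten for the free group \<open>G\<close>, in the form that Goldstein and Turner gave to it.
  Finiteness of the exceptional edges rests on the following computation. Write such an arc as
  \<open>a = ke\<close> with \<open>e \<in> A\<close>. As \<open>a\<close> separates the images of its own ends under \<open>f\<close>, the arc
  \<open>\<phi>(k)\<inverse> k e\<close> or its reverse lies on a chosen walk between the images of the ends of \<open>e\<close>, so it takes finitely many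
  values. By freeness it determines \<open>\<phi>(k)\<inverse> k\<close>, which in turn determines \<open>k\<close> up to left
  multiplication by a fixed point of \<open>\<phi>\<close>.\<close>
theorem finitely_generated_fixed_points:
  assumes \<phi>: "\<phi> \<in> hom G G"
    and A: "finite A" "A \<subseteq> arcs X" "\<And>a. a \<in> arcs X \<Longrightarrow> \<exists>g\<in>carrier G. \<exists>e\<in>A. a = \<beta> g e"
  shows "finitely_generated_group (G\<lparr>carrier := fixed_points G \<phi>\<rparr>)"
proof -
  interpret \<phi>: group_hom G G \<phi>
    using \<phi> by unfold_locales
  obtain f where fV: "\<And>x. x \<in> verts X \<Longrightarrow> f x \<in> verts X"
    and f: "\<And>g x. g \<in> carrier G \<Longrightarrow> x \<in> verts X \<Longrightarrow> f (\<alpha> g x) = \<alpha> (\<phi> g) (f x)"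
    using exists_twisted_equivariant_map[OF \<phi>] by metis
  define H where "H = fixed_points G \<phi>"
  have H: "subgroup H G"
    unfolding H_def by (rule subgroup_fixed_points_hom[OF \<phi>])
  have HG: "\<And>h. h \<in> H \<Longrightarrow> h \<in> carrier G \<and> \<phi> h = h"
    by (simp add: H_def fixed_points_def)
  have fH: "f (\<alpha> h x) = \<alpha> h (f x)" if "h \<in> H" "x \<in> verts X" for h x
    using f[of h x] HG[of h] that by simp

  \<comment> \<open>Good arcs point from their tail towards its image; by \<open>side_unique\<close> each vertex is the tail of
    at most one of them, and \<open>p\<close> follows it. Vertices that are not the tail of a good arc stay put.\<close>
  define good where "good a \<longleftrightarrow> a \<in> arcs X \<and> f (tail X a) \<in> side a" for a
  define p where "p x = (if \<exists>a. good a \<and> tail X a = x then head X (SOME a. good a \<and> tail X a = x) else x)" for x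
  have p: "p (tail X a) = head X a" if a: "good a" for a
  proof -
    define b where "b = (SOME b. good b \<and> tail X b = tail X a)"
    have b: "good b \<and> tail X b = tail X a"
      unfolding b_def by (rule someI[where P = "\<lambda>b. good b \<and> tail X b = tail X a" and x = a]) (simp add: a)
    then have "f (tail X a) \<in> side b"
      unfolding good_def by metis
    then have "b = a"
      using side_unique[of b a "f (tail X a)"] a b fV by (simp add: good_def)
    then have "(SOME b. good b \<and> tail X b = tail X a) = a"
      by (simp only: b_def)
    then show ?thesis
      using a by (auto simp: p_def)
  qed
  have p_else: "p x = x" if "\<nexists>a. good a \<and> tail X a = x" for x
    using that by (auto simp: p_def)
  have good_act: "good (\<beta> h a)" if "good a" "h \<in> H" for a h
    using that fH[of h "tail X a"] side_equivariant[of h a] HG[of h] act_arcs[of h a]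
    by (simp add: good_def tail_equivariant)

  interpret A: group_action "G\<lparr>carrier := H\<rparr>" "verts X" \<alpha>
    by (rule on_verts.subgroup_action_on[OF H])
  interpret F: free_functional_action "G\<lparr>carrier := H\<rparr>" "verts X" \<alpha> p
  proof unfold_locales
    fix g x assume "g \<in> carrier (G\<lparr>carrier := H\<rparr>)" "x \<in> verts X" "\<alpha> g x = x"
    then show "g = \<one>\<^bsub>G\<lparr>carrier := H\<rparr>\<^esub>"
      using free_on_verts HG by simp
  next
    fix x assume x: "x \<in> verts X"
    show "p x \<in> verts X"
    proof (cases "\<exists>a. good a \<and> tail X a = x")
      case True
      then obtain a where "good a" "tail X a = x"
        by blast
      then show ?thesis
        using p[of a] by (auto simp: good_def)
    qed (simp add: p_else x)
  next
    fix h x assume h: "h \<in> carrier (G\<lparr>carrier := H\<rparr>)" and x: "x \<in> verts X"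
    then have hH: "h \<in> H" and hG: "h \<in> carrier G"
      using HG by auto
    have inv: "inv h \<in> H"
      using H hH by (rule subgroup.m_inv_closed)
    show "p (\<alpha> h x) = \<alpha> h (p x)"
    proof (cases "\<exists>a. good a \<and> tail X a = x")
      case True
      then obtain a where a: "good a" "tail X a = x" "a \<in> arcs X"
        by (auto simp: good_def)
      then show ?thesis
        using p[OF a(1)] p[OF good_act[OF a(1) hH]] hG
        by (simp add: tail_equivariant head_equivariant)
    next
      case False
      have "\<nexists>a. good a \<and> tail X a = \<alpha> h x"
      proof
        assume "\<exists>a. good a \<and> tail X a = \<alpha> h x"
        then obtain a where a: "good a" "tail X a = \<alpha> h x" "a \<in> arcs X"
          by (auto simp: good_def)
        then have "good (\<beta> (inv h) a)" "tail X (\<beta> (inv h) a) = x"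
          using good_act[OF a(1) inv] hG x by (auto simp: tail_equivariant act_inv_verts)
        then show False
          using False by blast
      qed
      then show ?thesis
        using False by (simp add: p_else)
    qed
  qed

  define bad where "bad = {a \<in> arcs X. \<not> good a \<and> \<not> good (arev a)}"
  have "\<exists>k. \<forall>a\<in>arcs X. k a \<in> carrier G \<and> (\<exists>e\<in>A. a = \<beta> (k a) e)"
    using A(3) by metis
  then obtain k e where ke: "\<And>a. a \<in> arcs X \<Longrightarrow> k a \<in> carrier G \<and> e a \<in> A \<and> \<beta> (k a) (e a) = a"
    by metis
  have "\<exists>w. awalk (f (tail X a)) w (f (head X a))" if "a \<in> arcs X" for a
    using is_tree fV that by (auto simp: bidirected_tree_def strongly_connected_def reachable_awalk)
  then obtain W where W: "\<And>a. a \<in> arcs X \<Longrightarrow> awalk (f (tail X a)) (W a) (f (head X a))"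
    by metis
  \<comment> \<open>The pair \<open>(e, \<phi>(k)\<inverse> k e)\<close> attached to the arc \<open>a = ke\<close>.\<close>
  define c where "c a = (e a, \<beta> (inv (\<phi> (k a))) a)" for a
  have c_range: "c a \<in> Sigma A (\<lambda>e. set (W e) \<union> arev ` set (W e))" if "a \<in> bad" for a
  proof -
    have a: "a \<in> arcs X" "f (tail X a) \<notin> side a" "f (head X a) \<notin> side (arev a)"
      using that by (auto simp: bad_def good_def)
    then have sides: "f (tail X a) \<in> side (arev a)" "f (head X a) \<in> side a"
      using side_arev_iff[OF a(1)] fV by auto
    define a' where "a' = \<beta> (inv (\<phi> (k a))) a"
    have k: "k a \<in> carrier G" and e: "e a \<in> A" "e a \<in> arcs X" and ae: "\<beta> (k a) (e a) = a"
      using ke[OF a(1)] A by auto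
    have a': "a' \<in> arcs X" "\<beta> (inv (\<phi> (k a))) (arev a) = arev a'"
      using k a by (auto simp: a'_def act_arcs rev_equivariant)
    have "\<alpha> (inv (\<phi> (k a))) (f (tail X a)) = f (tail X (e a))"
      using k e ae f fV by (metis \<phi>.hom_closed act_inv_verts(1) tail_equivariant tail_in_verts)
    then have t: "f (tail X (e a)) \<in> side (arev a')"
      using side_equivariant[OF _ _ sides(1), of "inv (\<phi> (k a))"] k a a' by simp
    have "\<alpha> (inv (\<phi> (k a))) (f (head X a)) = f (head X (e a))"
      using k e ae f fV by (metis \<phi>.hom_closed act_inv_verts(1) head_equivariant head_in_verts)
    then have h: "f (head X (e a)) \<in> side a'"
      using side_equivariant[OF _ _ sides(2), of "inv (\<phi> (k a))"] k a a'_def by simp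
    have "a' \<in> set (W (e a)) \<or> arev a' \<in> set (W (e a))"
      using walk_crosses[OF W[OF e(2)] _ h] t side_arev_iff[OF a'(1)] fV e by simp
    then show ?thesis
      using e by (auto simp: c_def a'_def[symmetric]) (metis arev_arev image_eqI)
  qed
  have c_inj: "\<exists>h\<in>H. b = \<beta> h a" if ab: "a \<in> bad" "b \<in> bad" "c a = c b" for a b
  proof -
    have arcs: "a \<in> arcs X" "b \<in> arcs X"
      using ab by (auto simp: bad_def)
    define g where "g = k a"
    define l where "l = k b"
    define d where "d = e a"
    have g: "g \<in> carrier G" "\<beta> g d = a" and l: "l \<in> carrier G" "\<beta> l d = b" and d: "d \<in> arcs X"
      using ke[OF arcs(1)] ke[OF arcs(2)] ab A by (auto simp: c_def g_def l_def d_def)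
    have "\<beta> (inv (\<phi> g) \<otimes> g) d = \<beta> (inv (\<phi> l) \<otimes> l) d"
      using ab g l d by (simp add: on_arcs.composition_rule c_def g_def[symmetric] l_def[symmetric])
    then have eq: "inv (\<phi> g) \<otimes> g = inv (\<phi> l) \<otimes> l"
      using g l d by (intro free_on_arcs) auto
    have "\<phi> l \<otimes> inv (\<phi> g) = \<phi> l \<otimes> (inv (\<phi> g) \<otimes> g) \<otimes> inv g"
      using g l by (simp add: m_assoc)
    also have "\<dots> = l \<otimes> inv g"
      unfolding eq using g l by (simp add: m_assoc[symmetric])
    finally have "l \<otimes> inv g \<in> H"
      using g l by (simp add: H_def fixed_points_def)
    moreover have "b = \<beta> (l \<otimes> inv g) a"
      using g l d act_inv_arcs(1)[of g d] by (simp add: on_arcs.composition_rule act_arcs[OF g(1) d, unfolded g(2)])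
    ultimately show ?thesis
      by blast
  qed
  have "c ` bad \<subseteq> Sigma A (\<lambda>e. set (W e) \<union> arev ` set (W e))"
    using c_range by blast
  then have "finite (c ` bad)"
    by (rule finite_subset) (use A in auto)
  then obtain R where R: "R \<subseteq> bad" "finite R" "c ` bad = c ` R"
    using finite_subset_image[of "c ` bad" c bad] by blast
  have R_rep: "\<exists>h\<in>H. \<exists>r\<in>R. a = \<beta> h r" if a: "a \<in> bad" for a
  proof -
    obtain r where "r \<in> R" "c r = c a"
      using R(3) a by (metis imageE imageI)
    then show ?thesis
      using c_inj[of r a] R(1) a by blast
  qed

  obtain v0 where v0: "v0 \<in> verts X"
    using is_tree by (auto simp: bidirected_tree_def strongly_connected_def)
  define D where "D = (\<lambda>a. (tail X a, head X a)) ` R"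
  have "finitely_generated_group (G\<lparr>carrier := H\<rparr>)"
  proof (rule F.finitely_generated_if_cofinitely_functional[of D v0])
    show "finite D" "D \<subseteq> verts X \<times> verts X"
      using R by (auto simp: D_def bad_def)
    fix x assume x: "x \<in> verts X"
    let ?E = "{(x, y). x \<in> verts X \<and> y \<in> verts X \<and> (y = p x \<or> x = p y)} \<union>
      {(\<alpha> g x, \<alpha> g y) |g x y. g \<in> carrier (G\<lparr>carrier := H\<rparr>) \<and> (x, y) \<in> D}"
    have "arcs_ends X \<subseteq> ?E"
    proof
      fix z assume "z \<in> arcs_ends X"
      then obtain a where a: "a \<in> arcs X" "z = (tail X a, head X a)"
        by (auto simp: arcs_ends_def arc_to_ends_def)
      consider "good a" | "good (arev a)" | "a \<in> bad"
        using a by (auto simp: bad_def)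
      then show "z \<in> ?E"
      proof cases
        case 1
        then show ?thesis
          using a p[of a] by simp
      next
        case 2
        then show ?thesis
          using a p[of "arev a"] by simp
      next
        case 3
        then obtain h r where hr: "h \<in> H" "r \<in> R" "a = \<beta> h r"
          using R_rep by blast
        then have "z = (\<alpha> h (tail X r), \<alpha> h (head X r))"
          using a HG R(1) by (auto simp: bad_def tail_equivariant head_equivariant)
        moreover have "(tail X r, head X r) \<in> D"
          using hr by (simp add: D_def)
        ultimately show ?thesis
          using hr by auto
      qed
    qed
    then show "(v0, x) \<in> ?E\<^sup>*"
      using connected_ends[OF v0 x] rtrancl_mono by blast
  qed (rule v0)
  then show ?thesis
    by (simp add: H_def)
qed

end


section \<open>Trees of groups\<close>

text \<open>The set \<open>S\<close> spans a subtree that is a strict fundamental domain: it contains one vertex of each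
  orbit, and each arc has a translate with both ends in \<open>S\<close>. Such a set exists if and only if the
  quotient graph is a tree.\<close>
locale tree_of_groups = tree_action +
  fixes S
  assumes S_verts: "S \<subseteq> verts X" and S_nonempty: "S \<noteq> {}"
    and S_unique: "\<lbrakk>s \<in> S; s' \<in> S; g \<in> carrier G; \<alpha> g s = s'\<rbrakk> \<Longrightarrow> s = s'"
    and S_arcs: "a \<in> arcs X \<Longrightarrow> \<exists>g\<in>carrier G. \<exists>e\<in>arcs X. tail X e \<in> S \<and> head X e \<in> S \<and> a = \<beta> g e"
    and S_connected: "\<lbrakk>s \<in> S; s' \<in> S\<rbrakk> \<Longrightarrow>
      (s, s') \<in> {(tail X e, head X e) | e. e \<in> arcs X \<and> tail X e \<in> S \<and> head X e \<in> S}\<^sup>*"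
begin

abbreviation vertex_group :: "'c \<Rightarrow> 'a set" where
  "vertex_group x \<equiv> stabilizer G \<alpha> x"

text \<open>The translates of \<open>S\<close> by \<open>M\<close> are closed under passing to neighbours, hence cover the tree; thus
  every element of \<open>G\<close> agrees with an element of \<open>M\<close> on a point of \<open>S\<close>, up to the stabiliser of that
  point.\<close>
lemma generated_by_vertex_groups:
  assumes M: "subgroup M G" and S_M: "\<And>s. s \<in> S \<Longrightarrow> vertex_group s \<subseteq> M"
  shows "M = carrier G"
proof -
  have MG: "M \<subseteq> carrier G"
    using M by (rule subgroup.subset)
  have in_M: "g \<in> M" if "g \<in> carrier G" "h \<in> M" "s \<in> S" "s' \<in> S" "\<alpha> g s = \<alpha> h s'" for g h s s'
  proof -
    have sV: "s \<in> verts X" "s' \<in> verts X"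
      using that S_verts by auto
    have "\<alpha> (inv h \<otimes> g) s = s'"
      using that sV MG by (auto simp: on_verts.composition_rule act_inv_verts)
    then have "\<alpha> (inv h \<otimes> g) s = s"
      using S_unique[of s s' "inv h \<otimes> g"] that MG by auto
    moreover have "inv h \<otimes> g \<in> carrier G"
      using that MG by auto
    ultimately have "inv h \<otimes> g \<in> M"
      using S_M[OF that(3)] by (auto simp: stabilizer_def)
    then have "h \<otimes> (inv h \<otimes> g) \<in> M"
      using that M by (auto intro: subgroup.m_closed)
    then show ?thesis
      using that MG by (auto simp: m_assoc[symmetric])
  qed
  obtain s0 where s0: "s0 \<in> S" "s0 \<in> verts X"
    using S_nonempty S_verts by blast
  have orbit_M: "\<exists>h\<in>M. \<exists>s\<in>S. x = \<alpha> h s" if "x \<in> verts X" for x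
    using s0(2) that
  proof (induction rule: connected_induct)
    case base
    then show ?case
      using s0 subgroup.one_closed[OF M] on_verts.act_one by (metis)
  next
    case (step a)
    then obtain h s where hs: "h \<in> M" "s \<in> S" "tail X a = \<alpha> h s"
      by blast
    obtain g e where ge: "g \<in> carrier G" "e \<in> arcs X" "tail X e \<in> S" "head X e \<in> S" "a = \<beta> g e"
      using S_arcs[OF step(1)] by blast
    then have "g \<in> M"
      using hs by (intro in_M[of g h "tail X e" s]) (auto simp: tail_equivariant)
    then show ?case
      using ge head_equivariant by blast
  qed
  have "g \<in> M" if g: "g \<in> carrier G" for g
  proof -
    obtain h s where "h \<in> M" "s \<in> S" "\<alpha> g s0 = \<alpha> h s"
      using orbit_M[OF act_verts[OF g s0(2)]] by blast
    then show ?thesis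
      using g s0 by (intro in_M[of g h s0 s])
  qed
  then show ?thesis
    using MG by blast
qed

lemma orbit_representative: "x \<in> verts X \<Longrightarrow> \<exists>g\<in>carrier G. \<exists>s\<in>S. \<alpha> g s = x"
proof -
  assume x: "x \<in> verts X"
  obtain s0 where s0: "s0 \<in> S" "s0 \<in> verts X"
    using S_nonempty S_verts by blast
  show ?thesis
    using s0(2) x
  proof (induction rule: connected_induct)
    case base
    then show ?case
      using s0 on_verts.act_one by (metis one_closed)
  next
    case (step a)
    then show ?case
      using S_arcs[OF step(1)] by (metis head_equivariant)
  qed
qed

text \<open>A vertex \<open>x = gs\<close> with \<open>s \<in> S\<close> and the element \<open>g\<close> have a relative coordinate \<open>c x g\<close>: the value
  of \<open>\<rho>\<close> on the stabiliser element by which \<open>g\<close> differs from a chosen one with the same effect on \<open>s\<close>.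
  The coordinate has the desired behaviour under right multiplication, but depends on the choice of
  \<open>s\<close>. Across an arc \<open>a\<close> the coordinates of its two ends differ by an amount \<open>t a\<close> that is independent
  of \<open>g\<close>, since \<open>\<rho>\<close> agrees on both vertex groups, and on a tree this discrepancy can be integrated
  to a potential \<open>u\<close>. Subtracting \<open>u\<close> removes the dependence on \<open>s\<close>. In other words, a flat connection
  on a bundle over a tree has a global section.\<close>
lemma exists_quasi_hom:
  fixes \<rho> :: "'a \<Rightarrow> 'z :: ab_group_add"
  assumes add: "\<And>s x y. \<lbrakk>s \<in> S; x \<in> vertex_group s; y \<in> vertex_group s\<rbrakk> \<Longrightarrow> \<rho> (x \<otimes> y) = \<rho> x + \<rho> y"
  shows "\<exists>F. \<forall>g\<in>carrier G. \<forall>s\<in>S. \<forall>x\<in>vertex_group s. F (g \<otimes> x) = F g + \<rho> x"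
proof -
  obtain k where "\<And>x. x \<in> verts X \<Longrightarrow> k x \<in> carrier G \<and> (\<exists>s\<in>S. \<alpha> (k x) s = x)"
    using orbit_representative by metis
  then obtain r where k: "\<And>x. x \<in> verts X \<Longrightarrow> k x \<in> carrier G \<and> r x \<in> S \<and> \<alpha> (k x) (r x) = x"
    by metis
  define c where "c x g = \<rho> (inv (k x) \<otimes> g)" for x g
  have c_mult: "c (\<alpha> g s) (g \<otimes> y) = c (\<alpha> g s) g + \<rho> y"
    if g: "g \<in> carrier G" and s: "s \<in> S" and y: "y \<in> vertex_group s" for g s y
  proof -
    have sV: "s \<in> verts X"
      using s S_verts by blast
    define x where "x = \<alpha> g s"
    have x: "x \<in> verts X"
      unfolding x_def using g sV by (rule act_verts)
    have kx: "k x \<in> carrier G" "r x \<in> S" "\<alpha> (k x) (r x) = x" "r x \<in> verts X"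
      using k[OF x] S_verts by auto
    have "\<alpha> (inv (k x) \<otimes> g) s = \<alpha> (inv (k x)) (\<alpha> (k x) (r x))"
      using g sV kx by (simp add: on_verts.composition_rule x_def[symmetric])
    then have r: "\<alpha> (inv (k x) \<otimes> g) s = r x"
      using act_inv_verts(1)[OF kx(1,4)] by simp
    then have "s = r x"
      using S_unique[OF s kx(2) _ r] g kx by simp
    then have "inv (k x) \<otimes> g \<in> vertex_group s"
      using r g kx by (simp add: stabilizer_def)
    then have "\<rho> (inv (k x) \<otimes> g \<otimes> y) = \<rho> (inv (k x) \<otimes> g) + \<rho> y"
      using add s y by blast
    moreover have "y \<in> carrier G"
      using y by (simp add: stabilizer_def)
    ultimately show ?thesis
      using g kx by (simp add: c_def x_def[symmetric] m_assoc)
  qed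
  obtain h where "\<And>a. a \<in> arcs X \<Longrightarrow> h a \<in> carrier G \<and> (\<exists>e\<in>arcs X. tail X e \<in> S \<and> head X e \<in> S \<and> a = \<beta> (h a) e)"
    using S_arcs by metis
  then obtain e where h: "\<And>a. a \<in> arcs X \<Longrightarrow> h a \<in> carrier G \<and> e a \<in> arcs X \<and> tail X (e a) \<in> S \<and>
      head X (e a) \<in> S \<and> a = \<beta> (h a) (e a)"
    by metis
  define t where "t a = c (head X a) (h a) - c (tail X a) (h a)" for a
  have t: "t (\<beta> g d) = c (\<alpha> g (head X d)) g - c (\<alpha> g (tail X d)) g"
    if g: "g \<in> carrier G" and d: "d \<in> arcs X" "tail X d \<in> S" "head X d \<in> S" for g d
  proof -
    define a where "a = \<beta> g d"
    have a: "a \<in> arcs X"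
      unfolding a_def using g d(1) by (rule act_arcs)
    have ha: "h a \<in> carrier G" "e a \<in> arcs X" "tail X (e a) \<in> S" "head X (e a) \<in> S" "a = \<beta> (h a) (e a)"
      using h[OF a] by auto
    have same: "s = s' \<and> inv (h a) \<otimes> g \<in> vertex_group s'"
      if "\<alpha> g s = \<alpha> (h a) s'" "s \<in> S" "s' \<in> S" for s s'
    proof -
      have V: "s \<in> verts X" "s' \<in> verts X"
        using that S_verts by auto
      have "\<alpha> (inv (h a) \<otimes> g) s = s'"
        using that V g ha(1) by (simp add: on_verts.composition_rule act_inv_verts)
      moreover from this have "s = s'"
        using S_unique that g ha(1) by (metis inv_closed m_closed)
      ultimately show ?thesis
        using g ha(1) by (simp add: stabilizer_def)
    qed
    have "\<alpha> g (tail X d) = tail X a" "\<alpha> g (head X d) = head X a"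
      using g d by (auto simp: a_def tail_equivariant head_equivariant)
    moreover have "tail X a = \<alpha> (h a) (tail X (e a))" "head X a = \<alpha> (h a) (head X (e a))"
      using ha by (metis tail_equivariant, metis head_equivariant)
    ultimately have st: "tail X d = tail X (e a) \<and> inv (h a) \<otimes> g \<in> vertex_group (tail X (e a))"
      and sh: "head X d = head X (e a) \<and> inv (h a) \<otimes> g \<in> vertex_group (head X (e a))"
      using same d ha by auto
    have g_eq: "h a \<otimes> (inv (h a) \<otimes> g) = g"
      using g ha(1) by (simp add: m_assoc[symmetric])
    have "c (tail X a) g = c (tail X a) (h a) + \<rho> (inv (h a) \<otimes> g)"
      using c_mult[OF ha(1) ha(3), of "inv (h a) \<otimes> g"] st g_eq \<open>tail X a = \<alpha> (h a) _\<close> by simp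
    moreover have "c (head X a) g = c (head X a) (h a) + \<rho> (inv (h a) \<otimes> g)"
      using c_mult[OF ha(1) ha(4), of "inv (h a) \<otimes> g"] sh g_eq \<open>head X a = \<alpha> (h a) _\<close> by simp
    ultimately show ?thesis
      using g d by (simp add: t_def a_def[symmetric] \<open>\<alpha> g (tail X d) = _\<close> \<open>\<alpha> g (head X d) = _\<close>)
  qed
  have "t (arev a) = - t a" if a: "a \<in> arcs X" for a
  proof -
    have ha: "h a \<in> carrier G" "e a \<in> arcs X" "tail X (e a) \<in> S" "head X (e a) \<in> S" "a = \<beta> (h a) (e a)"
      using h[OF a] by auto
    have "arev a = \<beta> (h a) (arev (e a))"
      using ha by (metis rev_equivariant)
    then have "t (arev a) = c (\<alpha> (h a) (tail X (e a))) (h a) - c (\<alpha> (h a) (head X (e a))) (h a)"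
      using t[of "h a" "arev (e a)"] ha by simp
    moreover have "t a = c (\<alpha> (h a) (head X (e a))) (h a) - c (\<alpha> (h a) (tail X (e a))) (h a)"
      using t[of "h a" "e a"] ha by simp
    ultimately show ?thesis
      by simp
  qed
  then obtain u where u: "\<And>a. a \<in> arcs X \<Longrightarrow> u (head X a) = u (tail X a) + t a"
    using exists_potential[of t] by blast
  define F where "F s g = c (\<alpha> g s) g - u (\<alpha> g s)" for s g
  have F_adjacent: "F (tail X d) g = F (head X d) g"
    if g: "g \<in> carrier G" and d: "d \<in> arcs X" "tail X d \<in> S" "head X d \<in> S" for g d
    using u[OF act_arcs[OF g d(1)]] t[OF g d] g d
    by (simp add: F_def tail_equivariant head_equivariant)
  have F_indep: "F s g = F s' g" if g: "g \<in> carrier G" and s: "s \<in> S" "s' \<in> S" for g s s'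
    using S_connected[OF s]
    by (induction rule: rtrancl_induct) (use F_adjacent[OF g] in auto)
  have F_mult: "F s (g \<otimes> x) = F s g + \<rho> x"
    if "g \<in> carrier G" "s \<in> S" "x \<in> vertex_group s" for g s x
  proof -
    have "\<alpha> (g \<otimes> x) s = \<alpha> g s"
      using that S_verts by (auto simp: stabilizer_def on_verts.composition_rule)
    then show ?thesis
      using c_mult[OF that] by (simp add: F_def)
  qed
  obtain s0 where s0: "s0 \<in> S"
    using S_nonempty by blast
  have "F s0 (g \<otimes> x) = F s0 g + \<rho> x"
    if "g \<in> carrier G" "s \<in> S" "x \<in> vertex_group s" for g s x
  proof -
    have "x \<in> carrier G"
      using that by (simp add: stabilizer_def)
    then show ?thesis
      using F_mult[OF that] F_indep[OF _ s0 that(2)] that(1) by simp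
  qed
  then show ?thesis
    by (intro exI[of _ "F s0"]) blast
qed

text \<open>The universal property of the fundamental group of a tree of groups, for abelian targets: the
  elements \<open>h\<close> for which right multiplication by \<open>h\<close> shifts the function \<open>F\<close> of \<open>exists_quasi_hom\<close> by
  a constant form a subgroup that contains all vertex groups.\<close>
theorem exists_hom_extension:
  fixes \<rho> :: "'a \<Rightarrow> 'z :: ab_group_add"
  assumes add: "\<And>s x y. \<lbrakk>s \<in> S; x \<in> vertex_group s; y \<in> vertex_group s\<rbrakk> \<Longrightarrow> \<rho> (x \<otimes> y) = \<rho> x + \<rho> y"
  shows "\<exists>\<chi>. (\<forall>g\<in>carrier G. \<forall>h\<in>carrier G. \<chi> (g \<otimes> h) = \<chi> g + \<chi> h) \<and>
    (\<forall>s\<in>S. \<forall>x\<in>vertex_group s. \<chi> x = \<rho> x)"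
proof -
  obtain F where F: "\<And>g s x. g \<in> carrier G \<Longrightarrow> s \<in> S \<Longrightarrow> x \<in> vertex_group s \<Longrightarrow> F (g \<otimes> x) = F g + \<rho> x"
    using exists_quasi_hom[of \<rho>] add by metis
  define \<chi> where "\<chi> g = F g - F \<one>" for g
  have \<chi>_vertex: "\<chi> x = \<rho> x" if "s \<in> S" "x \<in> vertex_group s" for s x
    using F[of \<one> s x] that by (simp add: \<chi>_def stabilizer_def)
  define M where "M = {h \<in> carrier G. \<forall>g\<in>carrier G. F (g \<otimes> h) = F g + \<chi> h}"
  have "subgroup M G"
  proof
    show "M \<subseteq> carrier G" "\<one> \<in> M"
      by (auto simp: M_def \<chi>_def)
  next
    fix h h' assume h: "h \<in> M" "h' \<in> M"
    then have "F (g \<otimes> (h \<otimes> h')) = F g + \<chi> h + \<chi> h'" if "g \<in> carrier G" for g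
      using that by (simp add: M_def m_assoc[symmetric])
    moreover from this[of \<one>] have "\<chi> (h \<otimes> h') = \<chi> h + \<chi> h'"
      using h by (simp add: \<chi>_def M_def)
    ultimately show "h \<otimes> h' \<in> M"
      using h by (simp add: M_def add.assoc)
  next
    fix h assume h: "h \<in> M"
    have *: "F g = F (g \<otimes> inv h) + \<chi> h" if "g \<in> carrier G" for g
    proof -
      have "F (g \<otimes> inv h \<otimes> h) = F (g \<otimes> inv h) + \<chi> h"
        using h that by (simp add: M_def)
      then show ?thesis
        using h that by (simp add: M_def m_assoc)
    qed
    have "F (inv h) = F \<one> - \<chi> h"
      using *[of \<one>] h by (simp add: M_def eq_diff_eq)
    then have "\<chi> (inv h) = - \<chi> h"
      by (simp add: \<chi>_def[of "inv h"])
    then show "inv h \<in> M"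
      using * h by (simp add: M_def)
  qed
  moreover have "vertex_group s \<subseteq> M" if "s \<in> S" for s
    using that F \<chi>_vertex by (auto simp: M_def stabilizer_def)
  ultimately have "M = carrier G"
    by (rule generated_by_vertex_groups)
  then have "F (g \<otimes> h) = F g + \<chi> h" if "g \<in> carrier G" "h \<in> carrier G" for g h
    using that by (auto simp: M_def)
  then have "\<chi> (g \<otimes> h) = \<chi> g + \<chi> h" if "g \<in> carrier G" "h \<in> carrier G" for g h
    using that by (simp add: \<chi>_def)
  then show ?thesis
    using \<chi>_vertex by (intro exI[of _ \<chi>]) blast
qed

end


section \<open>Lifting a quotient tree\<close>

context tree_action
begin

definition arcs_within :: "'v set \<Rightarrow> 'e set" where
  "arcs_within S = {e \<in> arcs X. tail X e \<in> S \<and> head X e \<in> S}"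

definition edge_orbit :: "'e \<Rightarrow> 'e set set" where
  "edge_orbit a = {orbit G \<beta> a, orbit G \<beta> (arev a)}"

text \<open>\<open>S\<close> is connected and embeds into the quotient; \<open>E\<close> contains the edges of a spanning tree of it,
  whose number is what the Betti number is compared with.\<close>
definition partial_lift :: "'v set \<Rightarrow> 'e set \<Rightarrow> bool" where
  "partial_lift S E \<longleftrightarrow> finite S \<and> S \<subseteq> verts X \<and> inj_on (orbit G \<alpha>) S \<and>
     finite E \<and> E \<subseteq> arcs_within S \<and> inj_on edge_orbit E \<and> card S = Suc (card E) \<and>
     (\<forall>s\<in>S. \<forall>s'\<in>S. (s, s') \<in> ((\<lambda>e. (tail X e, head X e)) ` arcs_within S)\<^sup>*)"

lemma edge_orbit_eqD:
  assumes a: "a \<in> arcs X" and b: "b \<in> arcs X" and eq: "edge_orbit a = edge_orbit b"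
  shows "\<exists>g\<in>carrier G. a = \<beta> g b \<or> a = \<beta> g (arev b)"
proof -
  have "orbit G \<beta> a = orbit G \<beta> b \<or> orbit G \<beta> a = orbit G \<beta> (arev b)"
    using eq by (auto simp: edge_orbit_def doubleton_eq_iff)
  then show ?thesis
    using on_arcs.orbit_eqD[OF a b] on_arcs.orbit_eqD[OF a arev_in_arcs[OF b]] by blast
qed

text \<open>If some orbit is missed, connectedness gives an arc from the orbits that are met to one that is
  not, and this arc can be translated so that it starts in \<open>S\<close>. Its edge orbit is new because its
  head is in a new orbit.\<close>
lemma partial_lift_extend:
  assumes lift: "partial_lift S E" and ne: "S \<noteq> {}" and S: "orbit G \<alpha> ` S \<noteq> orbits G (verts X) \<alpha>"
  shows "\<exists>S' E'. partial_lift S' E' \<and> card S' = Suc (card S)"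
proof -
  have SV: "S \<subseteq> verts X" and E: "E \<subseteq> arcs_within S"
    using lift by (auto simp: partial_lift_def)
  obtain s0 where s0: "s0 \<in> S" "s0 \<in> verts X"
    using ne SV by blast
  have "orbit G \<alpha> ` S \<subseteq> orbits G (verts X) \<alpha>"
    using SV by (auto simp: orbits_def)
  then obtain y where y: "y \<in> verts X" "orbit G \<alpha> y \<notin> orbit G \<alpha> ` S"
    using S by (auto simp: orbits_def)
  have "\<exists>a\<in>arcs X. orbit G \<alpha> (tail X a) \<in> orbit G \<alpha> ` S \<and> orbit G \<alpha> (head X a) \<notin> orbit G \<alpha> ` S"
  proof (rule ccontr)
    assume "\<not> ?thesis"
    then have step: "\<And>a. a \<in> arcs X \<Longrightarrow> orbit G \<alpha> (tail X a) \<in> orbit G \<alpha> ` S \<Longrightarrow> orbit G \<alpha> (head X a) \<in> orbit G \<alpha> ` S"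
      by blast
    have "orbit G \<alpha> y \<in> orbit G \<alpha> ` S"
      using s0(2) y(1) by (induction rule: connected_induct) (use s0 step in auto)
    then show False
      using y by blast
  qed
  then obtain b s where b: "b \<in> arcs X" "orbit G \<alpha> (head X b) \<notin> orbit G \<alpha> ` S"
    and s: "s \<in> S" "orbit G \<alpha> s = orbit G \<alpha> (tail X b)"
    by (metis imageE)
  then obtain g where g: "g \<in> carrier G" "s = \<alpha> g (tail X b)"
    using on_verts.orbit_eqD[of s "tail X b"] SV by auto
  define a where "a = \<beta> g b"
  define x where "x = head X a"
  have a: "a \<in> arcs X" "tail X a = s" "head X a = x" "x \<in> verts X"
    using g b by (auto simp: a_def x_def act_arcs tail_equivariant)
  have "orbit G \<alpha> x = orbit G \<alpha> (head X b)"
    using g b by (simp add: a_def x_def head_equivariant on_verts.orbit_act)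
  then have x: "orbit G \<alpha> x \<notin> orbit G \<alpha> ` S" "x \<notin> S"
    using b by auto
  have edge: "edge_orbit a \<noteq> edge_orbit e" if e: "e \<in> E" for e
  proof
    have e': "e \<in> arcs X" "tail X e \<in> S" "head X e \<in> S"
      using e E by (auto simp: arcs_within_def)
    assume "edge_orbit a = edge_orbit e"
    then obtain h where h: "h \<in> carrier G" "a = \<beta> h e \<or> a = \<beta> h (arev e)"
      using edge_orbit_eqD a e' by blast
    then have "x = \<alpha> h (head X e) \<or> x = \<alpha> h (tail X e)"
      using a e' by (auto simp: head_equivariant)
    then have "orbit G \<alpha> x \<in> orbit G \<alpha> ` S"
      using h e' by (auto simp: on_verts.orbit_act)
    then show False
      using x by blast
  qed
  then have aE: "a \<notin> E"
    by blast
  let ?R = "\<lambda>S. ((\<lambda>e. (tail X e, head X e)) ` arcs_within S)\<^sup>*"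
  have R: "?R S \<subseteq> ?R (insert x S)"
    by (intro rtrancl_mono) (auto simp: arcs_within_def)
  have "a \<in> arcs_within (insert x S)" "arev a \<in> arcs_within (insert x S)"
    using a s by (auto simp: arcs_within_def)
  then have sx: "(s, x) \<in> ?R (insert x S)" "(x, s) \<in> ?R (insert x S)"
    using a by (force intro!: r_into_rtrancl)+
  have "(s', s) \<in> ?R (insert x S)" "(s, s') \<in> ?R (insert x S)" if "s' \<in> insert x S" for s'
    using that lift s sx R by (auto simp: partial_lift_def)
  then have "\<forall>s\<in>insert x S. \<forall>s'\<in>insert x S. (s, s') \<in> ?R (insert x S)"
    by (meson rtrancl_trans)
  moreover have "insert a E \<subseteq> arcs_within (insert x S)"
    using E \<open>a \<in> arcs_within _\<close> by (auto simp: arcs_within_def)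
  ultimately have "partial_lift (insert x S) (insert a E)"
    using lift a x aE edge by (auto simp: partial_lift_def)
  moreover have "card (insert x S) = Suc (card S)"
    using lift x by (simp add: partial_lift_def)
  ultimately show ?thesis
    by blast
qed

lemma exists_partial_lift:
  assumes "n < card (orbits G (verts X) \<alpha>)"
  shows "\<exists>S E. partial_lift S E \<and> card S = Suc n"
  using assms
proof (induction n)
  case 0
  obtain v where "v \<in> verts X"
    using is_tree by (auto simp: bidirected_tree_def strongly_connected_def)
  then have "partial_lift {v} {}"
    by (simp add: partial_lift_def)
  then show ?case
    by (intro exI[of _ "{v}"] exI[of _ "{}"]) simp
next
  case (Suc n)
  then obtain S E where SE: "partial_lift S E" "card S = Suc n"
    by auto
  have "card (orbit G \<alpha> ` S) = Suc n"
    using SE by (simp add: partial_lift_def card_image)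
  then have "orbit G \<alpha> ` S \<noteq> orbits G (verts X) \<alpha>"
    using Suc.prems by auto
  then show ?case
    using partial_lift_extend[OF SE(1)] SE(2) by force
qed

lemma edges_quotient:
  "edges (quotient_graph G X \<alpha> \<beta>) (quotient_arev G X arev \<beta>) = edge_orbit ` arcs X"
proof -
  have "quotient_arev G X arev \<beta> (orbit G \<beta> a) = orbit G \<beta> (arev a)" if "a \<in> arcs X" for a
    using that by (auto simp: quotient_arev_def orbits_def rev_orbit)
  then show ?thesis
    by (auto simp: edges_def quotient_graph_def orbits_def edge_orbit_def image_iff)
qed

text \<open>A lift that meets all vertex orbits has \<open>|V| - 1\<close> edge orbits; Betti number zero says that there
  are no others.\<close>
theorem exists_tree_of_groups:
  assumes betti: "betti_on_tree G X arev \<alpha> \<beta> 0"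
  shows "\<exists>S. finite S \<and> tree_of_groups G X arev \<alpha> \<beta> S"
proof -
  let ?V = "orbits G (verts X) \<alpha>"
  have fin: "finite ?V" "finite (orbits G (arcs X) \<beta>)"
    using betti fin_digraph.finite_verts fin_digraph.finite_arcs
    by (fastforce simp: betti_on_tree_def quotient_graph_def)+
  have "edge_orbit ` arcs X \<subseteq> Pow (orbits G (arcs X) \<beta>)"
    by (auto simp: edge_orbit_def orbits_def)
  then have fin_edges: "finite (edge_orbit ` arcs X)"
    using fin by (metis finite_Pow_iff finite_subset)
  have card: "card ?V = Suc (card (edge_orbit ` arcs X))"
    using betti by (simp add: betti_on_tree_def first_betti_def edges_quotient) (simp add: quotient_graph_def)
  then obtain S E where SE: "partial_lift S E" "card S = card ?V"
    using exists_partial_lift[of "card (edge_orbit ` arcs X)"] by auto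
  have SV: "S \<subseteq> verts X"
    using SE by (simp add: partial_lift_def)
  have E: "E \<subseteq> arcs_within S" "E \<subseteq> arcs X"
    using SE by (auto simp: partial_lift_def arcs_within_def)
  have "card (edge_orbit ` E) = card (edge_orbit ` arcs X)"
    using SE card by (simp add: partial_lift_def card_image)
  then have edges: "edge_orbit ` E = edge_orbit ` arcs X"
    using fin_edges E by (intro card_subset_eq) auto
  have "tree_of_groups G X arev \<alpha> \<beta> S"
  proof unfold_locales
    show "S \<subseteq> verts X"
      by (rule SV)
    show "S \<noteq> {}"
      using SE card by auto
  next
    fix s s' g assume "s \<in> S" "s' \<in> S" "g \<in> carrier G" "\<alpha> g s = s'"
    then show "s = s'"
      using SE on_verts.orbit_act[of g s] by (auto simp: partial_lift_def inj_on_def)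
  next
    fix a assume a: "a \<in> arcs X"
    then obtain e where e: "e \<in> E" "edge_orbit a = edge_orbit e"
      using edges by (metis imageE imageI)
    then have "e \<in> arcs X" "tail X e \<in> S" "head X e \<in> S"
      using E by (auto simp: arcs_within_def)
    then show "\<exists>g\<in>carrier G. \<exists>e\<in>arcs X. tail X e \<in> S \<and> head X e \<in> S \<and> a = \<beta> g e"
      using edge_orbit_eqD[OF a _ e(2)] by (metis arev_in_arcs head_arev tail_arev)
  next
    fix s s' assume "s \<in> S" "s' \<in> S"
    moreover have "(\<lambda>e. (tail X e, head X e)) ` arcs_within S =
        {(tail X e, head X e) |e. e \<in> arcs X \<and> tail X e \<in> S \<and> head X e \<in> S}"
      by (auto simp: arcs_within_def)
    ultimately show "(s, s') \<in> {(tail X e, head X e) |e. e \<in> arcs X \<and> tail X e \<in> S \<and> head X e \<in> S}\<^sup>*"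
      using SE by (simp add: partial_lift_def)
  qed
  then show ?thesis
    using SE by (auto simp: partial_lift_def)
qed

end


section \<open>Infinite cyclic subgroups and roots\<close>

context group
begin

lemma infinite_cyclic_generator:
  assumes H: "subgroup H G" and cyc: "infinite_cyclic_group (G\<lparr>carrier := H\<rparr>)"
  shows "\<exists>x\<in>H. H = range (\<lambda>k::int. x [^] k) \<and> (\<forall>k::int. x [^] k = \<one> \<longrightarrow> k = 0)"
proof -
  let ?H = "G\<lparr>carrier := H\<rparr>"
  interpret H: group ?H
    by (rule subgroup_imp_group[OF H])
  have "integer_group \<cong> ?H"
    using cyc by (auto simp: infinite_cyclic_group_def intro: H.iso_sym)
  then obtain f where f: "f \<in> iso integer_group ?H"
    by (auto simp: is_iso_def)
  then have hom: "f \<in> hom integer_group ?H" and bij: "bij_betw f UNIV H"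
    by (auto simp: iso_def)
  have f1: "f 1 \<in> H"
    using bij by (auto simp: bij_betw_def)
  have fk: "f k = f 1 [^] k" for k :: int
  proof -
    have "f (1 [^]\<^bsub>integer_group\<^esub> k) = f 1 [^]\<^bsub>?H\<^esub> k"
      using hom by (intro hom_int_pow) (auto intro: H.is_group)
    then show ?thesis
      using int_pow_consistent[OF H f1] by simp
  qed
  have "k = 0" if "f 1 [^] k = \<one>" for k :: int
  proof -
    have "f k = f 0"
      using that fk[of k] fk[of 0] by simp
    then show ?thesis
      using bij by (auto simp: bij_betw_def dest: injD)
  qed
  moreover have "range f = range (\<lambda>k::int. f 1 [^] k)"
    by (rule image_cong[OF refl fk])
  then have "H = range (\<lambda>k::int. f 1 [^] k)"
    using bij by (simp only: bij_betw_def)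
  ultimately show ?thesis
    using f1 by blast
qed

lemma infinite_cyclic_torsion_free:
  assumes H: "subgroup H G" "infinite_cyclic_group (G\<lparr>carrier := H\<rparr>)"
    and y: "y \<in> H" "y [^] (n::int) = \<one>" "n \<noteq> 0"
  shows "y = \<one>"
proof -
  obtain x where x: "x \<in> H" "H = range (\<lambda>k::int. x [^] k)" "\<And>k::int. x [^] k = \<one> \<Longrightarrow> k = 0"
    using infinite_cyclic_generator[OF H] by blast
  then obtain i :: int where i: "y = x [^] i"
    using y(1) by blast
  have "x \<in> carrier G"
    using H(1) x(1) by (rule subgroup.mem_carrier)
  then have "x [^] (i * n) = \<one>"
    using y(2) by (simp add: i int_pow_pow)
  then show ?thesis
    using x(3)[of "i * n"] y(3) i by simp
qed

lemma infinite_cyclic_commute: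
  assumes H: "subgroup H G" "infinite_cyclic_group (G\<lparr>carrier := H\<rparr>)"
    and y: "y \<in> H" "z \<in> H"
  shows "y \<otimes> z = z \<otimes> y"
proof -
  obtain x where x: "x \<in> H" "H = range (\<lambda>k::int. x [^] k)"
    using infinite_cyclic_generator[OF H] by blast
  then obtain i j :: int where "y = x [^] i" "z = x [^] j"
    using y by blast
  moreover have "x \<in> carrier G"
    using H(1) x(1) by (rule subgroup.mem_carrier)
  ultimately show ?thesis
    by (simp add: int_pow_mult[symmetric] add.commute)
qed

lemma infinite_cyclic_common_exponent:
  assumes H: "subgroup H G" "infinite_cyclic_group (G\<lparr>carrier := H\<rparr>)"
    and z: "z \<in> H" "z \<noteq> \<one>"
  shows "\<exists>n::int. n \<noteq> 0 \<and> (\<forall>y\<in>H. \<exists>m::int. y [^] n = z [^] m)"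
proof -
  obtain x where x: "x \<in> H" "H = range (\<lambda>k::int. x [^] k)"
    using infinite_cyclic_generator[OF H] by blast
  have xG: "x \<in> carrier G"
    using H(1) x(1) by (rule subgroup.mem_carrier)
  obtain j :: int where j: "z = x [^] j"
    using x z by blast
  have "j \<noteq> 0"
    using z j by auto
  moreover have "\<exists>m::int. y [^] j = z [^] m" if y: "y \<in> H" for y
  proof -
    obtain i :: int where i: "y = x [^] i"
      using x y by blast
    have "y [^] j = z [^] i"
      using xG by (simp add: i j int_pow_pow mult.commute)
    then show ?thesis
      by blast
  qed
  ultimately show ?thesis
    by blast
qed

lemma infinite_cyclic_nontrivial:
  assumes H: "subgroup H G" "infinite_cyclic_group (G\<lparr>carrier := H\<rparr>)"
  shows "\<exists>x\<in>H. x \<noteq> \<one>"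
proof -
  obtain x where x: "x \<in> H" "\<And>k::int. x [^] k = \<one> \<Longrightarrow> k = 0"
    using infinite_cyclic_generator[OF H] by blast
  have "x \<noteq> \<one>"
    using x(2)[of 1] by auto
  then show ?thesis
    using x by blast
qed

text \<open>The exponent \<open>r\<close> for which formally \<open>x = z\<^sup>r\<close>.\<close>
definition root_exponent :: "'a \<Rightarrow> 'a \<Rightarrow> rat" where
  "root_exponent z x = (THE r. \<exists>n m::int. n \<noteq> 0 \<and> x [^] n = z [^] m \<and> r = of_int m / of_int n)"

lemma root_exponent_eq:
  assumes z: "z \<in> carrier G" "\<And>k::int. z [^] k = \<one> \<Longrightarrow> k = 0"
    and x: "x \<in> carrier G" "x [^] (n::int) = z [^] (m::int)" "n \<noteq> 0"
  shows "root_exponent z x = of_int m / of_int n"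
  unfolding root_exponent_def
proof (rule the_equality)
  show "\<exists>n' m'::int. n' \<noteq> 0 \<and> x [^] n' = z [^] m' \<and> (of_int m / of_int n :: rat) = of_int m' / of_int n'"
    using x by blast
next
  fix r :: rat
  assume "\<exists>n' m'::int. n' \<noteq> 0 \<and> x [^] n' = z [^] m' \<and> r = of_int m' / of_int n'"
  then obtain n' m' :: int where n': "n' \<noteq> 0" "x [^] n' = z [^] m'" "r = of_int m' / of_int n'"
    by blast
  have "z [^] (m * n') = x [^] (n * n')"
    using x z by (simp add: int_pow_pow[symmetric])
  also have "\<dots> = z [^] (m' * n)"
    using n' x z by (simp add: int_pow_pow[symmetric] mult.commute[of n])
  finally have "z [^] (m * n' - m' * n) = \<one>"
    using z by (simp add: int_pow_diff)
  then have "m * n' = m' * n"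
    using z(2) by fastforce
  then have "(of_int m * of_int n' :: rat) = of_int m' * of_int n"
    by (metis of_int_mult)
  then show "r = of_int m / of_int n"
    using n' x by (simp add: frac_eq_eq)
qed

end


section \<open>Generalised Baumslag-Solitar groups\<close>

sublocale gbs_group_on_tree \<subseteq> tree_action G T arev \<alpha> \<beta>
  by unfold_locales (rule tree)

context gbs_group_on_tree
begin

lemma edge_stabilizer_subset:
  assumes "a \<in> arcs T"
  shows "stabilizer G \<beta> a \<subseteq> stabilizer G \<alpha> (tail T a) \<inter> stabilizer G \<alpha> (head T a)"
  using assms tail_equivariant head_equivariant by (fastforce simp: stabilizer_def)

text \<open>A tree has no parallel arcs: a second arc with the same ends would bypass the first one.\<close>
lemma fixes_arc_if_fixes_ends:
  assumes g: "g \<in> carrier G" and a: "a \<in> arcs T"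
    and ends: "\<alpha> g (tail T a) = tail T a" "\<alpha> g (head T a) = head T a"
  shows "\<beta> g a = a"
proof (rule ccontr)
  assume ne: "\<beta> g a \<noteq> a"
  have "tail T (\<beta> g a) \<in> side a"
    using side_step[of "\<beta> g a" a] no_inversion[OF g a] ne g a ends head_in_side
    by (simp add: act_arcs head_equivariant)
  then show False
    using g a ends tail_notin_side by (simp add: tail_equivariant)
qed

text \<open>Neighbouring vertex groups are commensurable: both are infinite cyclic and contain the nontrivial
  stabiliser of the edge between them.\<close>
lemma power_in_vertex_stabilizer:
  assumes v: "v \<in> verts T" and w: "w \<in> verts T"
    and y: "y \<in> stabilizer G \<alpha> v" "y \<noteq> \<one>"
  shows "\<exists>n::int. n \<noteq> 0 \<and> y [^] n \<in> stabilizer G \<alpha> w"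
  using v w
proof (induction rule: connected_induct)
  case base
  then show ?case
    using y by (intro exI[of _ 1]) (auto simp: stabilizer_def)
next
  case (step a)
  then obtain n :: int where n: "n \<noteq> 0" "y [^] n \<in> stabilizer G \<alpha> (tail T a)"
    by blast
  have yG: "y \<in> carrier G"
    using y by (simp add: stabilizer_def)
  have V: "subgroup (stabilizer G \<alpha> (tail T a)) G" "infinite_cyclic_group (G\<lparr>carrier := stabilizer G \<alpha> (tail T a)\<rparr>)"
    using step(1) by (auto intro: on_verts.stabilizer_subgroup vertex_stabilizer)
  have E: "subgroup (stabilizer G \<beta> a) G" "infinite_cyclic_group (G\<lparr>carrier := stabilizer G \<beta> a\<rparr>)"
    using step(1) by (auto intro: on_arcs.stabilizer_subgroup edge_stabilizer)
  obtain z where z: "z \<in> stabilizer G \<beta> a" "z \<noteq> \<one>"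
    using infinite_cyclic_nontrivial[OF E] by blast
  have "z \<in> stabilizer G \<alpha> (tail T a)"
    using z edge_stabilizer_subset[OF step(1)] by blast
  then obtain k m :: int where k: "k \<noteq> 0" "(y [^] n) [^] k = z [^] m"
    using infinite_cyclic_common_exponent[OF V _ z(2)] n(2) by blast
  have "z [^] m \<in> stabilizer G \<beta> a"
    using subgroup_int_pow_closed[OF E(1) z(1)] .
  then have "y [^] (n * k) \<in> stabilizer G \<alpha> (head T a)"
    using k yG edge_stabilizer_subset[OF step(1)] by (auto simp: int_pow_pow[symmetric])
  then show ?case
    using n k by (intro exI[of _ "n * k"]) auto
qed

lemma exists_common_stabilizer_element:
  assumes S: "finite S" "S \<subseteq> verts T"
  shows "\<exists>z\<in>carrier G. (\<forall>k::int. z [^] k = \<one> \<longrightarrow> k = 0) \<and> (\<forall>s\<in>S. z \<in> stabilizer G \<alpha> s)"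
proof -
  obtain v where v: "v \<in> verts T"
    using is_tree by (auto simp: bidirected_tree_def strongly_connected_def)
  have V: "subgroup (stabilizer G \<alpha> v) G" "infinite_cyclic_group (G\<lparr>carrier := stabilizer G \<alpha> v\<rparr>)"
    using v by (auto intro: on_verts.stabilizer_subgroup vertex_stabilizer)
  obtain y where y: "y \<in> stabilizer G \<alpha> v" "y \<noteq> \<one>"
    using infinite_cyclic_nontrivial[OF V] by blast
  have yG: "y \<in> carrier G"
    using y by (simp add: stabilizer_def)
  have "\<exists>n::int. n \<noteq> 0 \<and> (\<forall>s\<in>S. y [^] n \<in> stabilizer G \<alpha> s)"
    using S
  proof (induction rule: finite_induct)
    case empty
    then show ?case
      by (intro exI[of _ 1]) simp
  next
    case (insert s S)
    obtain n :: int where n: "n \<noteq> 0" "\<forall>s\<in>S. y [^] n \<in> stabilizer G \<alpha> s"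
      using insert by blast
    obtain m :: int where m: "m \<noteq> 0" "y [^] m \<in> stabilizer G \<alpha> s"
      using power_in_vertex_stabilizer[OF v _ y, of s] insert.prems by blast
    have "y [^] (n * m) \<in> stabilizer G \<alpha> s'" if "s' \<in> insert s S" for s'
    proof -
      have sub: "subgroup (stabilizer G \<alpha> s') G"
        using that insert.prems by (auto intro: on_verts.stabilizer_subgroup)
      have "(y [^] m) [^] n \<in> stabilizer G \<alpha> s'" if "s' = s"
        using subgroup_int_pow_closed[OF sub] m that by simp
      moreover have "(y [^] n) [^] m \<in> stabilizer G \<alpha> s'" if "s' \<in> S"
        using subgroup_int_pow_closed[OF sub] n that by simp
      ultimately show ?thesis
        using that yG by (auto simp: int_pow_pow mult.commute)
    qed
    then show ?case
      using n m by (intro exI[of _ "n * m"]) auto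
  qed
  then obtain n :: int where n: "n \<noteq> 0" "\<forall>s\<in>S. y [^] n \<in> stabilizer G \<alpha> s"
    by blast
  have "k = 0" if "(y [^] n) [^] k = \<one>" for k :: int
    using infinite_cyclic_torsion_free[OF V y(1), of "n * k"] y(2) yG n that
    by (auto simp: int_pow_pow)
  then show ?thesis
    using n yG by (intro bexI[of _ "y [^] n"]) auto
qed

end

locale gbs_tree_of_groups = gbs_group_on_tree G T arev \<alpha> \<beta> + tree_of_groups G T arev \<alpha> \<beta> S
  for G (structure) and T :: "('v, 'e) pre_digraph" and arev \<alpha> \<beta> S +
  assumes finite_S: "finite S"
begin

text \<open>An element common to all vertex groups of the finite set \<open>S\<close> commutes with each of these groups,
  which generate \<open>G\<close>. Being central, it fixes all translates of \<open>S\<close>.\<close>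
lemma exists_central_elliptic:
  "\<exists>z\<in>carrier G. (\<forall>k::int. z [^] k = \<one> \<longrightarrow> k = 0) \<and> (\<forall>x\<in>verts T. z \<in> stabilizer G \<alpha> x) \<and>
    (\<forall>g\<in>carrier G. z \<otimes> g = g \<otimes> z)"
proof -
  obtain z where z: "z \<in> carrier G" "\<And>k::int. z [^] k = \<one> \<Longrightarrow> k = 0" "\<And>s. s \<in> S \<Longrightarrow> z \<in> stabilizer G \<alpha> s"
    using exists_common_stabilizer_element[OF finite_S S_verts] by blast
  define M where "M = {g \<in> carrier G. z \<otimes> g = g \<otimes> z}"
  have "subgroup M G"
  proof
    show "M \<subseteq> carrier G" "\<one> \<in> M"
      using z(1) by (auto simp: M_def)
  next
    fix g h assume "g \<in> M" "h \<in> M"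
    then show "g \<otimes> h \<in> M"
      using z(1) by (simp add: M_def m_assoc[symmetric]) (simp add: m_assoc)
  next
    fix g assume g: "g \<in> M"
    then have gG: "g \<in> carrier G" and comm: "z \<otimes> g = g \<otimes> z"
      by (auto simp: M_def)
    have "inv g \<otimes> z = inv g \<otimes> (z \<otimes> g) \<otimes> inv g"
      using gG z(1) by (simp add: m_assoc)
    also have "\<dots> = z \<otimes> inv g"
      unfolding comm using gG z(1) by (simp add: m_assoc[symmetric])
    finally have "inv g \<otimes> z = z \<otimes> inv g" .
    then show "inv g \<in> M"
      using g by (simp add: M_def)
  qed
  moreover have "stabilizer G \<alpha> s \<subseteq> M" if "s \<in> S" for s
    using that S_verts z infinite_cyclic_commute[OF on_verts.stabilizer_subgroup vertex_stabilizer]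
    by (auto simp: M_def stabilizer_def)
  ultimately have M: "M = carrier G"
    by (rule generated_by_vertex_groups)
  have "z \<in> stabilizer G \<alpha> x" if x: "x \<in> verts T" for x
  proof -
    obtain g s where g: "g \<in> carrier G" "s \<in> S" "\<alpha> g s = x"
      using orbit_representative[OF x] by blast
    have "\<alpha> z x = \<alpha> (z \<otimes> g) s"
      using g z(1) S_verts by (auto simp: on_verts.composition_rule)
    also have "z \<otimes> g = g \<otimes> z"
      using g M by (auto simp: M_def)
    also have "\<alpha> (g \<otimes> z) s = x"
      using g z(1) z(3)[OF g(2)] S_verts by (auto simp: on_verts.composition_rule stabilizer_def)
    finally show ?thesis
      using z(1) by (simp add: stabilizer_def)
  qed
  then show ?thesis
    using z(1,2) M by (auto simp: M_def)
qed

end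


context gbs_tree_of_groups
begin

text \<open>The homomorphism is the extension of \<open>root_exponent z\<close>, multiplied by a common denominator \<open>N\<close>
  for the vertex groups of the finite set \<open>S\<close>. It is unique up to proportionality because a nonzero power of each element of a
  vertex group is a power of \<open>z\<close>, so its value is determined by that of \<open>z\<close>.\<close>
theorem exists_rank_one_hom:
  "\<exists>\<chi> z. \<chi> \<in> hom G integer_group \<and>
    (\<forall>x\<in>verts T. \<forall>g\<in>stabilizer G \<alpha> x. \<chi> g = 0 \<longrightarrow> g = \<one>) \<and>
    z \<in> carrier G \<and> (\<forall>x\<in>verts T. \<alpha> z x = x) \<and> \<chi> z \<noteq> 0 \<and>
    (\<forall>\<psi>\<in>hom G integer_group. \<forall>g\<in>carrier G. \<chi> z * \<psi> g = \<psi> z * \<chi> g)"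
proof -
  obtain z where z: "z \<in> carrier G" "\<And>k::int. z [^] k = \<one> \<Longrightarrow> k = 0"
    and z_stab: "\<And>x. x \<in> verts T \<Longrightarrow> z \<in> stabilizer G \<alpha> x"
    using exists_central_elliptic by blast
  have z1: "z \<noteq> \<one>"
    using z(2)[of 1] by auto
  have V: "subgroup (stabilizer G \<alpha> s) G" "infinite_cyclic_group (G\<lparr>carrier := stabilizer G \<alpha> s\<rparr>)"
    if "s \<in> S" for s
    using that S_verts by (auto intro: on_verts.stabilizer_subgroup vertex_stabilizer)
  have VG: "x \<in> carrier G" if "x \<in> stabilizer G \<alpha> s" for x s
    using that by (simp add: stabilizer_def)
  have "\<exists>n::int. n \<noteq> 0 \<and> (\<forall>y\<in>stabilizer G \<alpha> s. \<exists>m::int. y [^] n = z [^] m)" if "s \<in> S" for s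
    using infinite_cyclic_common_exponent[OF V[OF that] z_stab z1] that S_verts by blast
  then obtain e :: "'v \<Rightarrow> int" where e: "\<And>s. s \<in> S \<Longrightarrow> e s \<noteq> 0"
    "\<And>s y. s \<in> S \<Longrightarrow> y \<in> stabilizer G \<alpha> s \<Longrightarrow> \<exists>m::int. y [^] e s = z [^] m"
    by metis
  let ?\<rho> = "root_exponent z"
  have \<rho>: "?\<rho> x = of_int m / of_int n" if "x \<in> carrier G" "x [^] n = z [^] m" "n \<noteq> 0" for x and n m :: int
    using root_exponent_eq[OF z that] .
  have "?\<rho> (x \<otimes> y) = ?\<rho> x + ?\<rho> y"
    if s: "s \<in> S" and x: "x \<in> stabilizer G \<alpha> s" and y: "y \<in> stabilizer G \<alpha> s" for s x y
  proof -
    obtain m k :: int where mk: "x [^] e s = z [^] m" "y [^] e s = z [^] k"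
      using e s x y by metis
    have "(x \<otimes> y) [^] e s = z [^] (m + k)"
      using int_pow_mult_distrib[OF infinite_cyclic_commute[OF V[OF s] x y] VG[OF x] VG[OF y]] z(1)
      by (simp add: mk int_pow_mult)
    then show ?thesis
      using \<rho> mk e(1)[OF s] VG[OF x] VG[OF y] by (simp add: add_divide_distrib)
  qed
  then obtain \<chi>0 :: "'a \<Rightarrow> rat" where \<chi>0: "\<And>g h. g \<in> carrier G \<Longrightarrow> h \<in> carrier G \<Longrightarrow> \<chi>0 (g \<otimes> h) = \<chi>0 g + \<chi>0 h"
    and \<chi>0_S: "\<And>s x. s \<in> S \<Longrightarrow> x \<in> stabilizer G \<alpha> s \<Longrightarrow> \<chi>0 x = ?\<rho> x"
    using exists_hom_extension[of ?\<rho>] by metis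
  define N where "N = prod e S"
  have N: "N \<noteq> 0"
    using e(1) finite_S by (simp add: N_def)
  have \<chi>0_one: "\<chi>0 \<one> = 0"
    using \<chi>0[of \<one> \<one>] by simp
  have \<chi>0_inv: "\<chi>0 (inv g) = - \<chi>0 g" if "g \<in> carrier G" for g
    using \<chi>0[of "inv g" g] that \<chi>0_one by (simp add: add_eq_0_iff)
  define M where "M = {g \<in> carrier G. \<exists>k::int. of_int N * \<chi>0 g = of_int k}"
  have "subgroup M G"
  proof
    show "M \<subseteq> carrier G" "\<one> \<in> M"
      using \<chi>0_one by (auto simp: M_def)
  next
    fix g h assume "g \<in> M" "h \<in> M"
    then show "g \<otimes> h \<in> M"
      using \<chi>0 by (auto simp: M_def distrib_left) (metis of_int_add)
  next
    fix g assume "g \<in> M"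
    then show "inv g \<in> M"
      using \<chi>0_inv by (auto simp: M_def) (metis of_int_minus)
  qed
  moreover have "stabilizer G \<alpha> s \<subseteq> M" if s: "s \<in> S" for s
  proof
    fix x assume x: "x \<in> stabilizer G \<alpha> s"
    obtain m :: int where m: "x [^] e s = z [^] m"
      using e s x by blast
    obtain q where q: "N = e s * q"
      using dvd_prodI[OF finite_S s, of e] by (auto simp: N_def dvd_def)
    have "of_int N * \<chi>0 x = of_int (q * m)"
      using \<chi>0_S[OF s x] \<rho>[OF VG[OF x] m e(1)[OF s]] e(1)[OF s] by (simp add: q)
    then show "x \<in> M"
      unfolding M_def using VG[OF x] by blast
  qed
  ultimately have "M = carrier G"
    by (rule generated_by_vertex_groups)
  then have integral: "\<exists>k::int. of_int N * \<chi>0 g = of_int k" if "g \<in> carrier G" for g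
    using that by (auto simp: M_def)
  define \<chi> where "\<chi> g = \<lfloor>of_int N * \<chi>0 g\<rfloor>" for g
  have \<chi>: "of_int (\<chi> g) = of_int N * \<chi>0 g" if "g \<in> carrier G" for g
    using integral[OF that] by (auto simp: \<chi>_def)
  have \<chi>_hom: "\<chi> \<in> hom G integer_group"
  proof (rule homI)
    fix g h assume gh: "g \<in> carrier G" "h \<in> carrier G"
    then have "(of_int (\<chi> (g \<otimes> h)) :: rat) = of_int (\<chi> g + \<chi> h)"
      by (simp add: \<chi> \<chi>0 distrib_left)
    then show "\<chi> (g \<otimes> h) = \<chi> g \<otimes>\<^bsub>integer_group\<^esub> \<chi> h"
      by (simp only: of_int_eq_iff mult_integer_group)
  qed simp
  obtain s0 where s0: "s0 \<in> S"
    using S_nonempty by blast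
  have "of_int (\<chi> z) = (of_int N :: rat)"
    using \<chi>[OF z(1)] \<chi>0_S[OF s0 z_stab] s0 S_verts \<rho>[OF z(1), of 1 1] by auto
  then have \<chi>z: "\<chi> z \<noteq> 0"
    using N by simp
  have inj_S: "x = \<one>" if s: "s \<in> S" and x: "x \<in> stabilizer G \<alpha> s" and 0: "\<chi> x = 0" for s x
  proof -
    obtain m :: int where m: "x [^] e s = z [^] m"
      using e s x by blast
    then have "e s * \<chi> x = m * \<chi> z"
      using int_hom_int_pow[OF \<chi>_hom VG[OF x], of "e s"] int_hom_int_pow[OF \<chi>_hom z(1), of m] by simp
    then have "x [^] e s = \<one>"
      using 0 \<chi>z m by simp
    then show ?thesis
      using infinite_cyclic_torsion_free[OF V[OF s] x] e(1)[OF s] by blast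
  qed
  have inj: "y = \<one>" if x: "x \<in> verts T" and y: "y \<in> stabilizer G \<alpha> x" and 0: "\<chi> y = 0" for x y
  proof -
    obtain g s where g: "g \<in> carrier G" "s \<in> S" "\<alpha> g s = x"
      using orbit_representative[OF x] by blast
    have sV: "s \<in> verts T"
      using g S_verts by blast
    have yG: "y \<in> carrier G" "\<alpha> y x = x"
      using y by (auto simp: stabilizer_def)
    have "\<alpha> (inv g \<otimes> (y \<otimes> g)) s = s"
      using g sV yG x act_inv_verts(1)[OF g(1) sV] by (simp add: on_verts.composition_rule act_verts)
    then have "inv g \<otimes> (y \<otimes> g) \<in> stabilizer G \<alpha> s"
      using g yG by (simp add: stabilizer_def)
    moreover have "\<chi> (inv g \<otimes> (y \<otimes> g)) = 0"
      using g yG 0 by (simp add: int_hom_mult[OF \<chi>_hom] int_hom_inv[OF \<chi>_hom])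
    ultimately have *: "inv g \<otimes> (y \<otimes> g) = \<one>"
      using inj_S g(2) by blast
    have "y = g \<otimes> (inv g \<otimes> (y \<otimes> g)) \<otimes> inv g"
      using g yG by (simp add: m_assoc) (simp add: m_assoc[symmetric])
    then show ?thesis
      unfolding * using g by simp
  qed
  have rank_one: "\<chi> z * \<psi> g = \<psi> z * \<chi> g" if \<psi>: "\<psi> \<in> hom G integer_group" and g: "g \<in> carrier G" for \<psi> g
  proof -
    define L where "L = {g \<in> carrier G. \<chi> z * \<psi> g = \<psi> z * \<chi> g}"
    note homs = int_hom_mult[OF \<chi>_hom] int_hom_mult[OF \<psi>] int_hom_inv[OF \<chi>_hom] int_hom_inv[OF \<psi>]
    have "subgroup L G"
    proof
      show "L \<subseteq> carrier G" "\<one> \<in> L"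
        using homs(1)[of \<one> \<one>] homs(2)[of \<one> \<one>] by (auto simp: L_def)
    qed (auto simp: L_def homs distrib_left)
    moreover have "stabilizer G \<alpha> s \<subseteq> L" if s: "s \<in> S" for s
    proof
      fix x assume x: "x \<in> stabilizer G \<alpha> s"
      obtain m :: int where m: "x [^] e s = z [^] m"
        using e s x by blast
      have *: "e s * f x = m * f z" if f: "f \<in> hom G integer_group" for f
        using int_hom_int_pow[OF f VG[OF x], of "e s"] int_hom_int_pow[OF f z(1), of m] m by simp
      have "e s * (\<chi> z * \<psi> x) = \<chi> z * (e s * \<psi> x)"
        by simp
      also have "\<dots> = \<psi> z * (m * \<chi> z)"
        by (simp add: *[OF \<psi>])
      also have "\<dots> = e s * (\<psi> z * \<chi> x)"
        by (simp add: *[OF \<chi>_hom, symmetric])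
      finally show "x \<in> L"
        using e(1)[OF s] VG[OF x] by (simp add: L_def)
    qed
    ultimately have "L = carrier G"
      by (rule generated_by_vertex_groups)
    then show ?thesis
      using g by (auto simp: L_def)
  qed
  show ?thesis
    using \<chi>_hom inj z(1) z_stab \<chi>z rank_one
    by (intro exI[of _ \<chi>] exI[of _ z]) (simp add: stabilizer_def)
qed

text \<open>The kernel \<open>K\<close> of the homomorphism \<open>\<chi>\<close> of \<open>exists_rank_one_hom\<close> is preserved by \<open>\<phi>\<close>, since
  \<open>\<chi> \<circ> \<phi>\<close> is proportional to \<open>\<chi>\<close>. It acts freely, so its fixed points are finitely generated, and
  they are the kernel of \<open>\<chi>\<close> restricted to all fixed points.\<close>
theorem finitely_generated_fixed_points_hom:
  assumes fin: "finite (orbits G (arcs T) \<beta>)" and \<phi>: "\<phi> \<in> hom G G"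
  shows "finitely_generated_group (G\<lparr>carrier := fixed_points G \<phi>\<rparr>)"
proof -
  obtain \<chi> z where \<chi>: "\<chi> \<in> hom G integer_group"
    and inj: "\<And>x g. x \<in> verts T \<Longrightarrow> g \<in> stabilizer G \<alpha> x \<Longrightarrow> \<chi> g = 0 \<Longrightarrow> g = \<one>"
    and z: "z \<in> carrier G" "\<And>x. x \<in> verts T \<Longrightarrow> \<alpha> z x = x" "\<chi> z \<noteq> 0"
    and rank_one: "\<And>\<psi> g. \<psi> \<in> hom G integer_group \<Longrightarrow> g \<in> carrier G \<Longrightarrow> \<chi> z * \<psi> g = \<psi> z * \<chi> g"
    using exists_rank_one_hom by blast
  interpret \<chi>: group_hom G integer_group \<chi>
    using \<chi> by (simp add: group_hom_def group_hom_axioms_def is_group)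
  define K where "K = kernel G integer_group \<chi>"
  have K: "subgroup K G"
    unfolding K_def by (rule \<chi>.subgroup_kernel)
  have K_iff: "g \<in> K \<longleftrightarrow> g \<in> carrier G \<and> \<chi> g = 0" for g
    by (simp add: K_def kernel_def)
  have \<phi>G: "\<phi> g \<in> carrier G" if "g \<in> carrier G" for g
    using \<phi> that by (auto simp: hom_def)
  have "\<chi> \<circ> \<phi> \<in> hom G integer_group"
    using \<phi> \<chi> by (rule Group.hom_compose)
  then have "\<chi> z * \<chi> (\<phi> g) = \<chi> (\<phi> z) * \<chi> g" if "g \<in> carrier G" for g
    using rank_one[of "\<chi> \<circ> \<phi>" g] that by simp
  then have \<phi>K: "\<phi> g \<in> K" if "g \<in> K" for g
    using that z(3) \<phi>G by (fastforce simp: K_iff)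
  have \<phi>_K: "\<phi> \<in> hom (G\<lparr>carrier := K\<rparr>) (G\<lparr>carrier := K\<rparr>)"
    using \<phi> \<phi>K K_iff by (auto simp: hom_def)

  interpret KV: group_action "G\<lparr>carrier := K\<rparr>" "verts T" \<alpha>
    by (rule on_verts.subgroup_action_on[OF K])
  interpret KA: group_action "G\<lparr>carrier := K\<rparr>" "arcs T" \<beta>
    by (rule on_arcs.subgroup_action_on[OF K])
  interpret K: free_tree_action "G\<lparr>carrier := K\<rparr>" T arev \<alpha> \<beta>
  proof unfold_locales
    fix g x assume "g \<in> carrier (G\<lparr>carrier := K\<rparr>)" "x \<in> verts T" "\<alpha> g x = x"
    then show "g = \<one>\<^bsub>G\<lparr>carrier := K\<rparr>\<^esub>"
      using inj[of x g] by (simp add: K_iff stabilizer_def)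
  qed (use K_iff tail_equivariant head_equivariant rev_equivariant no_inversion in auto)

  obtain R where R: "R \<subseteq> arcs T" "finite R" "orbits G (arcs T) \<beta> = orbit G \<beta> ` R"
  proof -
    have "orbits G (arcs T) \<beta> \<subseteq> orbit G \<beta> ` arcs T"
      by (auto simp: orbits_def)
    then show ?thesis
      using finite_subset_image[OF fin] that by metis
  qed
  have "\<exists>g\<in>carrier G. \<exists>r\<in>R. a = \<beta> g r" if a: "a \<in> arcs T" for a
  proof -
    have "orbit G \<beta> a \<in> orbit G \<beta> ` R"
      using a R(3) by (auto simp: orbits_def)
    then show ?thesis
      using on_arcs.orbit_eqD[OF a] R(1) by blast
  qed
  then obtain k r where kr: "\<And>a. a \<in> arcs T \<Longrightarrow> k a \<in> carrier G \<and> r a \<in> R \<and> a = \<beta> (k a) (r a)"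
    by metis
  \<comment> \<open>Arcs \<open>g r\<close> and \<open>g' r\<close> with \<open>\<chi> g \<equiv> \<chi> g'\<close> modulo \<open>\<chi> z\<close> are in the same \<open>K\<close>-orbit, because \<open>g'\<close>
    can be corrected by a power of \<open>z\<close>, which acts trivially on the tree.\<close>
  define c where "c a = (r a, \<chi> (k a) mod \<bar>\<chi> z\<bar>)" for a
  have "c ` arcs T \<subseteq> R \<times> {0..<\<bar>\<chi> z\<bar>}"
    using kr z(3) by (auto simp: c_def)
  then have "finite (c ` arcs T)"
    by (rule finite_subset) (use R(2) in simp)
  then obtain A where A: "A \<subseteq> arcs T" "finite A" "c ` arcs T = c ` A"
    using finite_subset_image[of "c ` arcs T" c "arcs T"] by blast
  have z_arcs: "\<beta> (z [^] q) a = a" if a: "a \<in> arcs T" for q :: int and a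
  proof -
    have "\<beta> z a = a"
      using z a by (intro fixes_arc_if_fixes_ends) auto
    then have "z \<in> stabilizer G \<beta> a"
      using z by (simp add: stabilizer_def)
    then have "z [^] q \<in> stabilizer G \<beta> a"
      by (rule subgroup_int_pow_closed[OF on_arcs.stabilizer_subgroup[OF a]])
    then show ?thesis
      by (simp add: stabilizer_def)
  qed
  have A_rep: "\<exists>g\<in>K. \<exists>a\<in>A. b = \<beta> g a" if b: "b \<in> arcs T" for b
  proof -
    obtain a where a: "a \<in> A" "c a = c b"
      using A(3) b by (metis imageE imageI)
    then have aT: "a \<in> arcs T"
      using A by blast
    have ka: "k a \<in> carrier G" "r a \<in> arcs T" "a = \<beta> (k a) (r a)"
      and kb: "k b \<in> carrier G" "r b = r a" "b = \<beta> (k b) (r b)"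
      using kr[OF aT] kr[OF b] R(1) a(2) by (auto simp: c_def)
    have "\<bar>\<chi> z\<bar> dvd \<chi> (k b) - \<chi> (k a)"
      using a(2) by (intro mod_eq_dvd_iff[THEN iffD1]) (simp add: c_def)
    then have "\<chi> z dvd \<chi> (k b) - \<chi> (k a)"
      by simp
    then obtain q where q: "\<chi> (k b) - \<chi> (k a) = \<chi> z * q"
      by (auto simp: dvd_def)
    define g where "g = k b \<otimes> inv (k a) \<otimes> z [^] (- q)"
    have "\<chi> g = 0"
      using q ka kb z(1)
      by (simp add: g_def int_hom_mult[OF \<chi>] int_hom_inv[OF \<chi>] int_hom_int_pow[OF \<chi>] mult.commute)
    then have "g \<in> K"
      using ka kb z(1) by (simp add: K_iff g_def)
    moreover have "\<beta> g a = b"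
    proof -
      have "\<beta> g a = \<beta> (k b) (\<beta> (inv (k a)) a)"
        using ka(1) kb(1) z(1) aT z_arcs[OF aT, of "- q"] by (simp add: g_def on_arcs.composition_rule act_arcs)
      also have "\<beta> (inv (k a)) a = r a"
        using act_inv_arcs(1)[OF ka(1,2)] ka(3) by simp
      finally show ?thesis
        using kb by simp
    qed
    ultimately show ?thesis
      using a(1) by blast
  qed
  have fg: "finitely_generated_group (G\<lparr>carrier := fixed_points (G\<lparr>carrier := K\<rparr>) \<phi>\<rparr>)"
    using K.finitely_generated_fixed_points[OF \<phi>_K A(2,1)] A_rep by simp

  let ?F = "fixed_points G \<phi>"
  have F: "subgroup ?F G"
    by (rule subgroup_fixed_points_hom[OF \<phi>])
  show ?thesis
  proof (rule finitely_generated_by_kernel)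
    show "group (G\<lparr>carrier := ?F\<rparr>)"
      by (rule subgroup_imp_group[OF F])
    show "\<chi> \<in> hom (G\<lparr>carrier := ?F\<rparr>) integer_group"
      by (intro homI) (simp_all add: int_hom_mult[OF \<chi>] subgroup.mem_carrier[OF F])
    have "kernel (G\<lparr>carrier := ?F\<rparr>) integer_group \<chi> = fixed_points (G\<lparr>carrier := K\<rparr>) \<phi>"
      by (auto simp: kernel_def fixed_points_def K_iff)
    then show "finitely_generated_group (G\<lparr>carrier := ?F, carrier := kernel (G\<lparr>carrier := ?F\<rparr>) integer_group \<chi>\<rparr>)"
      using fg by simp
  qed
qed

end

theorem theoremE:
  fixes G :: "('a, 'm) monoid_scheme"
    and T :: "('v, 'e) pre_digraph"
    and arev :: "'e \<Rightarrow> 'e"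
    and \<alpha> :: "'a \<Rightarrow> 'v \<Rightarrow> 'v"
    and \<beta> :: "'a \<Rightarrow> 'e \<Rightarrow> 'e"
    and \<phi> :: "'a \<Rightarrow> 'a"
  assumes "gbs_group_on_tree G T arev \<alpha> \<beta>"
    and "\<not> elementary_gbs_group G"
    and "betti_on_tree G T arev \<alpha> \<beta> 0"
    and "\<phi> \<in> auto G"
  shows "finitely_generated_group (G\<lparr>carrier := fixed_points G \<phi>\<rparr>)"
proof -
  interpret gbs_group_on_tree G T arev \<alpha> \<beta>
    by fact
  obtain S where "finite S" "tree_of_groups G T arev \<alpha> \<beta> S"
    using exists_tree_of_groups[OF assms(3)] by blast
  then interpret gbs_tree_of_groups G T arev \<alpha> \<beta> S
    unfolding gbs_tree_of_groups_def gbs_tree_of_groups_axioms_def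
    using assms(1) by blast
  have "finite (orbits G (arcs T) \<beta>)"
    using assms(3) fin_digraph.finite_arcs by (fastforce simp: betti_on_tree_def quotient_graph_def)
  then show ?thesis
    using assms(4) by (intro finitely_generated_fixed_points_hom) (simp_all add: auto_def)
qed

end
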